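(* Let $m,n\ge2$, let $\theta$ be a permutation of $\{1,\dots,m\}\times\{1,\dots,n\}$, and let $a,b$ be positive integers. (A) Suppose that $\mathbb{F}_\theta^+$ is $(a,-b)$-periodic, with associated bijection $\gamma:\mathbf m^a\to\mathbf n^b$. Let $u_0\in\mathbf m^a$ and let $j_0\in\mathbf n$ be arbitrary. Define $j_1,\dots,j_b\in\mathbf n$, $u_1,\dots,u_b\in\mathbf m^a$, and $j\in\mathbf n$, $u\in\mathbf m^a$ by the commutation relations $$e_{u_k}f_{j_k}=f_{j_{k+1}}e_{u_{k+1}}\quad(0\le k\le b-1),\qquad e_{u_b}f_{j_b}=f_je_u .$$ Then $\gamma(u_0)=v_0:=j_1j_2\cdots j_b$, and also $j=j_0$ and $u=u_0$. Conversely in direction, let $i_0\in\mathbf m$ be arbitrary and define $i_1,\dots,i_a\in\mathbf m$, $v_1,\dots,v_a\in\mathbf n^b$, $i\in\mathbf m$, $v\in\mathbf n^b$ by $$e_{i_k}f_{v_k}=f_{v_{k+1}}e_{i_{k+1}}\quad(0\le k\le a-1),\qquad e_{i_a}f_{v_a}=f_ve_i .$$ Then $\gamma^{-1}(v_0)=i_ai_{a-1}\cdots i_1=u_0$, and also $v=v_0$ and $i=i_0$. (B) Conversely, suppose $m^a=n^b$ and that for each $u_0\in\mathbf m^a$ the procedure passes all the tests of equality for all $j_0\in\mathbf n$ and all $i_0\in\mathbf m$; that is: for every $u_0\in\mathbf m^a$, the word $v_0=j_1\cdots j_b$ produced by the first computation is the same for every $j_0\in\mathbf n$, with $j=j_0$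 and $u=u_0$ in each case, and, starting from this $v_0$, for every $i_0\in\mathbf m$ the second computation gives $i_ai_{a-1}\cdots i_1=u_0$, $v=v_0$ and $i=i_0$. Then $\mathbb{F}_\theta^+$ is $(a,-b)$-periodic.
   Context: Semigroup. For a permutation $\theta$ of $\{1,\dots,m\}\times\{1,\dots,n\}$, $\mathbb{F}_\theta^+$ is the unital semigroup generated by $e_1,\dots,e_m,f_1,\dots,f_n$ subject only to the relations $e_if_j=f_{j'}e_{i'}$ whenever $\theta(i,j)=(i',j')$. A word with $k$ $e$'s and $l$ $f$'s has degree $d(w)=(k,l)$. Every element of degree $(k,l)$ can be uniquely factored with any prescribed pattern of $k$ $e$'s and $l$ $f$'s. Write $\mathbf m=\{1,\dots,m\}$, $\mathbf n=\{1,\dots,n\}$, and $e_u=e_{i_1}\cdots e_{i_a}$ for $u=i_1\cdots i_a\in\mathbf m^a$, similarly $f_v$ for $v\in\mathbf n^b$. Tails and periodicity. A tail is an infinite word $\tau=e_{i_0}f_{j_0}e_{i_1}f_{j_1}\cdots$. Let $\tau_T=e_{i_0}f_{j_0}\cdots e_{i_{T-1}}f_{j_{T-1}}$. For integers $s,t\le 0$, choose $T>\max(|s|,|t|)$, factor $\tau_T=w_1w_2$ with $d(w_1)=(|s|,|t|)$, and write $w_2=e_iw'=f_jw''$; then $i_{s,t}:=i$, $j_{s,t}:=j$ (independent of $T$). The tail is $(p,q)$-periodic if $(i_{s+p,t+q},j_{s+p,t+q})=(i_{s,t},j_{s,t})$ whenever $s,t,s+p,t+q\le0$. For $a,b>0$,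 $\mathbb{F}_\theta^+$ is $(a,-b)$-periodic if every tail is $(a,-b)$-periodic; equivalently (for $m,n\ge2$), $m^a=n^b$ and there is a (unique) bijection $\gamma:\mathbf m^a\to\mathbf n^b$ with $e_uf_v=f_{\gamma(u)}e_{\gamma^{-1}(v)}$ for all $u\in\mathbf m^a$, $v\in\mathbf n^b$. This $\gamma$ is the associated bijection. *)

theory Defs
  imports "HOL-Algebra.Group" "HOL-Combinatorics.Permutations"
begin

datatype letter = E nat | F nat

definition alphabet :: "nat \<Rightarrow> nat \<Rightarrow> letter set" where
  "alphabet m n = E ` {1..m} \<union> F ` {1..n}"

definition words :: "nat \<Rightarrow> nat \<Rightarrow> nat list set" where
  "words m a = {u. set u \<subseteq> {1..m} \<and> length u = a}"

text \<open>The congruence on the free monoid over the alphabet generated by the relations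
  \<open>e\<^sub>i f\<^sub>j = f\<^sub>j\<^sub>' e\<^sub>i\<^sub>'\<close>, where \<open>\<theta> (i, j) = (i', j')\<close>.
  The range conditions on \<open>i'\<close> and \<open>j'\<close> are automatic when \<open>\<theta>\<close> is a permutation.\<close>

inductive_set F_cong :: "nat \<Rightarrow> nat \<Rightarrow> (nat \<times> nat \<Rightarrow> nat \<times> nat) \<Rightarrow> (letter list \<times> letter list) set"
  for m n \<theta> where
  comm: "i \<in> {1..m} \<Longrightarrow> j \<in> {1..n} \<Longrightarrow> \<theta> (i, j) = (i', j') \<Longrightarrow>
    i' \<in> {1..m} \<Longrightarrow> j' \<in> {1..n} \<Longrightarrow> ([E i, F j], [F j', E i']) \<in> F_cong m n \<theta>"
| refl: "w \<in> lists (alphabet m n) \<Longrightarrow> (w, w) \<in> F_cong m n \<theta>"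
| sym: "(w, z) \<in> F_cong m n \<theta> \<Longrightarrow> (z, w) \<in> F_cong m n \<theta>"
| trans: "(w, y) \<in> F_cong m n \<theta> \<Longrightarrow> (y, z) \<in> F_cong m n \<theta> \<Longrightarrow> (w, z) \<in> F_cong m n \<theta>"
| append: "(w, w') \<in> F_cong m n \<theta> \<Longrightarrow> (z, z') \<in> F_cong m n \<theta> \<Longrightarrow>
    (w @ z, w' @ z') \<in> F_cong m n \<theta>"

definition F_class :: "nat \<Rightarrow> nat \<Rightarrow> (nat \<times> nat \<Rightarrow> nat \<times> nat) \<Rightarrow> letter list \<Rightarrow> letter list set" where
  "F_class m n \<theta> w = F_cong m n \<theta> `` {w}"

definition F_semigroup :: "nat \<Rightarrow> nat \<Rightarrow> (nat \<times> nat \<Rightarrow> nat \<times> nat) \<Rightarrow> letter list set monoid" where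
  "F_semigroup m n \<theta> =
    \<lparr>carrier = lists (alphabet m n) // F_cong m n \<theta>,
     monoid.mult = (\<lambda>A B. \<Union>w\<in>A. \<Union>z\<in>B. F_class m n \<theta> (w @ z)),
     one = F_class m n \<theta> []\<rparr>"

definition e_elt :: "nat \<Rightarrow> nat \<Rightarrow> (nat \<times> nat \<Rightarrow> nat \<times> nat) \<Rightarrow> nat list \<Rightarrow> letter list set" where
  "e_elt m n \<theta> u = F_class m n \<theta> (map E u)"

definition f_elt :: "nat \<Rightarrow> nat \<Rightarrow> (nat \<times> nat \<Rightarrow> nat \<times> nat) \<Rightarrow> nat list \<Rightarrow> letter list set" where
  "f_elt m n \<theta> v = F_class m n \<theta> (map F v)"

definition word_deg :: "letter list \<Rightarrow> nat \<times> nat" where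
  "word_deg w = (length (filter (\<lambda>x. \<exists>i. x = E i) w), length (filter (\<lambda>x. \<exists>j. x = F j) w))"

text \<open>Congruent words have the same degree (\<open>F_cong_word_deg\<close> below), so the image of a class
  under \<open>word_deg\<close> is a singleton.\<close>

definition elt_deg :: "letter list set \<Rightarrow> nat \<times> nat" where
  "elt_deg A = the_elem (word_deg ` A)"

text \<open>A tail is given by its two sequences of indices \<open>I k\<close> and \<open>J k\<close>.\<close>

definition is_tail :: "nat \<Rightarrow> nat \<Rightarrow> (nat \<Rightarrow> nat) \<Rightarrow> (nat \<Rightarrow> nat) \<Rightarrow> bool" where
  "is_tail m n I J \<longleftrightarrow> (\<forall>k. I k \<in> {1..m} \<and> J k \<in> {1..n})"

definition tail_prefix ::
  "nat \<Rightarrow> nat \<Rightarrow> (nat \<times> nat \<Rightarrow> nat \<times> nat) \<Rightarrow> (nat \<Rightarrow> nat) \<Rightarrow> (nat \<Rightarrow> nat) \<Rightarrow> nat \<Rightarrow> letter list set" where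
  "tail_prefix m n \<theta> I J T = F_class m n \<theta> (concat (map (\<lambda>k. [E (I k), F (J k)]) [0..<T]))"

text \<open>The pair \<open>(i\<^sub>s\<^sub>,\<^sub>t, j\<^sub>s\<^sub>,\<^sub>t)\<close>, meaningful for \<open>s, t \<le> 0\<close>. It does not depend on \<open>T\<close>.\<close>

definition tail_label ::
  "nat \<Rightarrow> nat \<Rightarrow> (nat \<times> nat \<Rightarrow> nat \<times> nat) \<Rightarrow> (nat \<Rightarrow> nat) \<Rightarrow> (nat \<Rightarrow> nat) \<Rightarrow> int \<Rightarrow> int \<Rightarrow> nat \<times> nat" where
  "tail_label m n \<theta> I J s t = (THE (i, j). i \<in> {1..m} \<and> j \<in> {1..n} \<and>
     (\<exists>T. int T > max \<bar>s\<bar> \<bar>t\<bar> \<and>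
       (\<exists>w\<^sub>1 \<in> carrier (F_semigroup m n \<theta>). \<exists>w\<^sub>2 \<in> carrier (F_semigroup m n \<theta>).
        \<exists>w' \<in> carrier (F_semigroup m n \<theta>). \<exists>w'' \<in> carrier (F_semigroup m n \<theta>).
          tail_prefix m n \<theta> I J T = w\<^sub>1 \<otimes>\<^bsub>F_semigroup m n \<theta>\<^esub> w\<^sub>2 \<and>
          elt_deg w\<^sub>1 = (nat \<bar>s\<bar>, nat \<bar>t\<bar>) \<and>
          w\<^sub>2 = e_elt m n \<theta> [i] \<otimes>\<^bsub>F_semigroup m n \<theta>\<^esub> w' \<and>
          w\<^sub>2 = f_elt m n \<theta> [j] \<otimes>\<^bsub>F_semigroup m n \<theta>\<^esub> w'')))"

definition tail_periodic ::
  "nat \<Rightarrow> nat \<Rightarrow> (nat \<times> nat \<Rightarrow> nat \<times> nat) \<Rightarrow> (nat \<Rightarrow> nat) \<Rightarrow> (nat \<Rightarrow> nat) \<Rightarrow> int \<Rightarrow> int \<Rightarrow> bool" where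
  "tail_periodic m n \<theta> I J p q \<longleftrightarrow>
    (\<forall>s t. s \<le> 0 \<and> t \<le> 0 \<and> s + p \<le> 0 \<and> t + q \<le> 0 \<longrightarrow>
      tail_label m n \<theta> I J (s + p) (t + q) = tail_label m n \<theta> I J s t)"

definition F_periodic :: "nat \<Rightarrow> nat \<Rightarrow> (nat \<times> nat \<Rightarrow> nat \<times> nat) \<Rightarrow> int \<Rightarrow> int \<Rightarrow> bool" where
  "F_periodic m n \<theta> p q \<longleftrightarrow> (\<forall>I J. is_tail m n I J \<longrightarrow> tail_periodic m n \<theta> I J p q)"

text \<open>The bijection \<open>\<gamma>\<close> associated with \<open>(a, -b)\<close>-periodicity. Membership in \<^const>\<open>extensional\<close>
  fixes the irrelevant values outside \<open>words m a\<close>, so that \<open>\<gamma>\<close> is unique as a total function.\<close>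

definition assoc_bij ::
  "nat \<Rightarrow> nat \<Rightarrow> (nat \<times> nat \<Rightarrow> nat \<times> nat) \<Rightarrow> nat \<Rightarrow> nat \<Rightarrow> nat list \<Rightarrow> nat list" where
  "assoc_bij m n \<theta> a b = (THE \<gamma>. \<gamma> \<in> extensional (words m a) \<and>
     bij_betw \<gamma> (words m a) (words n b) \<and>
     (\<forall>u\<in>words m a. \<forall>v\<in>words n b.
        e_elt m n \<theta> u \<otimes>\<^bsub>F_semigroup m n \<theta>\<^esub> f_elt m n \<theta> v =
        f_elt m n \<theta> (\<gamma> u) \<otimes>\<^bsub>F_semigroup m n \<theta>\<^esub> e_elt m n \<theta> (inv_into (words m a) \<gamma> v)))"

text \<open>The sequences \<open>j\<^sub>0, \<dots>, j\<^sub>b, j\<close> and \<open>u\<^sub>0, \<dots>, u\<^sub>b, u\<close> determined by \<open>u\<^sub>0\<close> and \<open>j\<^sub>0\<close> (by unique factorisation) through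
  \<open>e\<^bsub>u k\<^esub> f\<^bsub>j k\<^esub> = f\<^bsub>j (k+1)\<^esub> e\<^bsub>u (k+1)\<^esub>\<close>. Values of \<open>js\<close> and \<open>us\<close> beyond \<open>b\<close> play no role.\<close>

definition ef_run ::
  "nat \<Rightarrow> nat \<Rightarrow> (nat \<times> nat \<Rightarrow> nat \<times> nat) \<Rightarrow> nat \<Rightarrow> nat \<Rightarrow> nat list \<Rightarrow> nat \<Rightarrow>
   (nat \<Rightarrow> nat) \<Rightarrow> (nat \<Rightarrow> nat list) \<Rightarrow> nat \<Rightarrow> nat list \<Rightarrow> bool" where
  "ef_run m n \<theta> a b u\<^sub>0 j\<^sub>0 js us j u \<longleftrightarrow>
     us 0 = u\<^sub>0 \<and> js 0 = j\<^sub>0 \<and>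
     (\<forall>k\<le>b. us k \<in> words m a \<and> js k \<in> {1..n}) \<and> u \<in> words m a \<and> j \<in> {1..n} \<and>
     (\<forall>k<b. e_elt m n \<theta> (us k) \<otimes>\<^bsub>F_semigroup m n \<theta>\<^esub> f_elt m n \<theta> [js k] =
            f_elt m n \<theta> [js (k + 1)] \<otimes>\<^bsub>F_semigroup m n \<theta>\<^esub> e_elt m n \<theta> (us (k + 1))) \<and>
     e_elt m n \<theta> (us b) \<otimes>\<^bsub>F_semigroup m n \<theta>\<^esub> f_elt m n \<theta> [js b] =
       f_elt m n \<theta> [j] \<otimes>\<^bsub>F_semigroup m n \<theta>\<^esub> e_elt m n \<theta> u"

text \<open>Likewise \<open>i\<^sub>0, \<dots>, i\<^sub>a, i\<close> and \<open>v\<^sub>0, \<dots>, v\<^sub>a, v\<close>, determined by \<open>v\<^sub>0\<close> and \<open>i\<^sub>0\<close>.\<close>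

definition fe_run ::
  "nat \<Rightarrow> nat \<Rightarrow> (nat \<times> nat \<Rightarrow> nat \<times> nat) \<Rightarrow> nat \<Rightarrow> nat \<Rightarrow> nat list \<Rightarrow> nat \<Rightarrow>
   (nat \<Rightarrow> nat) \<Rightarrow> (nat \<Rightarrow> nat list) \<Rightarrow> nat \<Rightarrow> nat list \<Rightarrow> bool" where
  "fe_run m n \<theta> a b v\<^sub>0 i\<^sub>0 il vs i v \<longleftrightarrow>
     vs 0 = v\<^sub>0 \<and> il 0 = i\<^sub>0 \<and>
     (\<forall>k\<le>a. vs k \<in> words n b \<and> il k \<in> {1..m}) \<and> v \<in> words n b \<and> i \<in> {1..m} \<and>
     (\<forall>k<a. e_elt m n \<theta> [il k] \<otimes>\<^bsub>F_semigroup m n \<theta>\<^esub> f_elt m n \<theta> (vs k) =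
            f_elt m n \<theta> (vs (k + 1)) \<otimes>\<^bsub>F_semigroup m n \<theta>\<^esub> e_elt m n \<theta> [il (k + 1)]) \<and>
     e_elt m n \<theta> [il a] \<otimes>\<^bsub>F_semigroup m n \<theta>\<^esub> f_elt m n \<theta> (vs a) =
       f_elt m n \<theta> v \<otimes>\<^bsub>F_semigroup m n \<theta>\<^esub> e_elt m n \<theta> [i]"

lemma F_cong_lists:
  "(w, z) \<in> F_cong m n \<theta> \<Longrightarrow> w \<in> lists (alphabet m n) \<and> z \<in> lists (alphabet m n)"
  by (induction rule: F_cong.induct) (auto simp: alphabet_def)

lemma F_cong_equiv: "equiv (lists (alphabet m n)) (F_cong m n \<theta>)"
proof (rule equivI)
  show "F_cong m n \<theta> \<subseteq> lists (alphabet m n) \<times> lists (alphabet m n)"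
    by (rule subrelI) (simp only: mem_Sigma_iff, rule F_cong_lists)
  show "refl_on (lists (alphabet m n)) (F_cong m n \<theta>)"
    by (rule refl_onI) (rule F_cong.refl)
  show "sym (F_cong m n \<theta>)"
    by (rule symI) (rule F_cong.sym)
  show "trans (F_cong m n \<theta>)"
    by (rule transI) (rule F_cong.trans)
qed

lemma F_cong_word_deg: "(w, z) \<in> F_cong m n \<theta> \<Longrightarrow> word_deg w = word_deg z"
  by (induction rule: F_cong.induct) (auto simp: word_deg_def)

lemma F_class_mult:
  assumes "w \<in> lists (alphabet m n)" "z \<in> lists (alphabet m n)"
  shows "F_class m n \<theta> w \<otimes>\<^bsub>F_semigroup m n \<theta>\<^esub> F_class m n \<theta> z = F_class m n \<theta> (w @ z)"
proof -
  have "F_class m n \<theta> (w' @ z') = F_class m n \<theta> (w @ z)"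
    if "w' \<in> F_class m n \<theta> w" "z' \<in> F_class m n \<theta> z" for w' z'
    using that equiv_class_eq[OF F_cong_equiv F_cong.append, of w w' m n \<theta> z z']
    by (simp add: F_class_def)
  moreover have "F_class m n \<theta> w \<noteq> {}" "F_class m n \<theta> z \<noteq> {}"
    using assms F_cong.refl[of w m n \<theta>] F_cong.refl[of z m n \<theta>] by (auto simp: F_class_def)
  ultimately have "(\<Union>w'\<in>F_class m n \<theta> w. \<Union>z'\<in>F_class m n \<theta> z. F_class m n \<theta> (w' @ z')) =
      F_class m n \<theta> (w @ z)"
    by (simp cong: SUP_cong)
  then show ?thesis
    by (simp add: F_semigroup_def)
qed

lemma F_semigroup_monoid: "monoid (F_semigroup m n \<theta>)"
proof -
  have car: "carrier (F_semigroup m n \<theta>) = F_class m n \<theta> ` lists (alphabet m n)"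
    by (auto simp: F_semigroup_def quotient_def F_class_def)
  have one: "\<one>\<^bsub>F_semigroup m n \<theta>\<^esub> = F_class m n \<theta> []"
    by (simp add: F_semigroup_def)
  have app: "w @ z \<in> lists (alphabet m n)"
    if "w \<in> lists (alphabet m n)" "z \<in> lists (alphabet m n)" for w z
    using that by simp
  have nil: "[] \<in> lists (alphabet m n)"
    by simp
  show ?thesis
  proof (rule monoidI, unfold car one)
    fix x y z
    assume "x \<in> F_class m n \<theta> ` lists (alphabet m n)" "y \<in> F_class m n \<theta> ` lists (alphabet m n)"
      "z \<in> F_class m n \<theta> ` lists (alphabet m n)"
    then obtain u v w where
      "u \<in> lists (alphabet m n)" "x = F_class m n \<theta> u"
      "v \<in> lists (alphabet m n)" "y = F_class m n \<theta> v"
      "w \<in> lists (alphabet m n)" "z = F_class m n \<theta> w"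
      by blast
    then show "x \<otimes>\<^bsub>F_semigroup m n \<theta>\<^esub> y \<otimes>\<^bsub>F_semigroup m n \<theta>\<^esub> z =
        x \<otimes>\<^bsub>F_semigroup m n \<theta>\<^esub> (y \<otimes>\<^bsub>F_semigroup m n \<theta>\<^esub> z)"
      by (simp only: F_class_mult app append_assoc)
  next
    fix x y
    assume "x \<in> F_class m n \<theta> ` lists (alphabet m n)" "y \<in> F_class m n \<theta> ` lists (alphabet m n)"
    then obtain u v where
      "u \<in> lists (alphabet m n)" "x = F_class m n \<theta> u"
      "v \<in> lists (alphabet m n)" "y = F_class m n \<theta> v"
      by blast
    then show "x \<otimes>\<^bsub>F_semigroup m n \<theta>\<^esub> y \<in> F_class m n \<theta> ` lists (alphabet m n)"
      by (simp only: F_class_mult app imageI)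
  next
    fix x
    assume "x \<in> F_class m n \<theta> ` lists (alphabet m n)"
    then obtain u where u: "u \<in> lists (alphabet m n)" "x = F_class m n \<theta> u"
      by blast
    show "F_class m n \<theta> [] \<otimes>\<^bsub>F_semigroup m n \<theta>\<^esub> x = x"
      "x \<otimes>\<^bsub>F_semigroup m n \<theta>\<^esub> F_class m n \<theta> [] = x"
      using u nil by (simp_all only: F_class_mult append_Nil append_Nil2)
  next
    show "F_class m n \<theta> [] \<in> F_class m n \<theta> ` lists (alphabet m n)"
      using nil by (rule imageI)
  qed
qed

end

theory Submission
  imports Defs
begin

text \<open>Everything rests on unique factorisation. The semigroup acts on pairs \<open>(u, v)\<close> by left
  multiplication on the normal forms \<open>e\<^sub>u f\<^sub>v\<close>, so these are distinct (\<open>EF_unique\<close>); a count gives the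
  same for \<open>f\<^sub>v e\<^sub>u\<close> (\<open>FE_unique\<close>). Hence left factors of equal degree cancel
  (\<open>cancel_left\<close>), and the label of a tail at a position can be read off from any factorisation of any
  sufficiently long prefix (\<open>tail_label_eq\<close>).

  Periodicity says that every tail has the same letters after removal of its prefix of degree
  \<open>(a, 0)\<close> as after removal of its prefix of degree \<open>(0, b)\<close>. Apply this to
  \<open>e\<^sub>u f\<^sub>v z = f\<^bsub>v'\<^esub> e\<^bsub>u'\<^esub> z\<close>: the remainders \<open>f\<^sub>v z\<close> and \<open>e\<^bsub>u'\<^esub> z\<close> agree for all \<open>z\<close>, so \<open>v\<close> and \<open>u'\<close>
  determine each other. This is the bijection \<open>\<gamma>\<close> (\<open>periodic_imp_intertwines\<close>), and conversely
  such a bijection makes the two remainders agree (\<open>intertwines_imp_periodic\<close>).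

  The relations of a run compose to \<open>e\<^bsub>u\<^sub>0\<^esub> f\<^bsub>j\<^sub>0 \<cdots> j\<^bsub>b-1\<^esub>\<^esub> = f\<^bsub>j\<^sub>1 \<cdots> j\<^sub>b\<^esub> e\<^bsub>u\<^sub>b\<^esub>\<close>, which exhibits \<open>\<gamma>(u\<^sub>0)\<close>, and the
  same relation shifted by one index exhibits the return to the starting point. For the converse,
  let \<open>\<gamma>(u\<^sub>0)\<close> be the word produced by the runs from \<open>u\<^sub>0\<close>. As runs close up, \<open>\<gamma>(u)\<close> acts as a
  queue: when \<open>e\<^sub>u\<close> moves past a letter, whichever it is, it emits the head of the queue and appends
  that letter (\<open>ef_runs_imp_intertwines\<close>). Past a whole word \<open>v\<close> of length \<open>b\<close> it emits
  \<open>\<gamma>(u)\<close> and stores \<open>v\<close>, which is the intertwining relation.\<close>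

section \<open>Words and their degrees\<close>

lemma E_in_alphabet [simp]: "E i \<in> alphabet m n \<longleftrightarrow> i \<in> {1..m}"
  by (auto simp: alphabet_def)

lemma F_in_alphabet [simp]: "F j \<in> alphabet m n \<longleftrightarrow> j \<in> {1..n}"
  by (auto simp: alphabet_def)

lemma map_E_in_lists [simp]: "map E u \<in> lists (alphabet m n) \<longleftrightarrow> set u \<subseteq> {1..m}"
  by (induction u) auto

lemma map_F_in_lists [simp]: "map F v \<in> lists (alphabet m n) \<longleftrightarrow> set v \<subseteq> {1..n}"
  by (induction v) auto

lemma word_deg_simps [simp]:
  "word_deg [] = (0, 0)"
  "fst (word_deg (E i # w)) = Suc (fst (word_deg w))"
  "snd (word_deg (E i # w)) = snd (word_deg w)"
  "fst (word_deg (F j # w)) = fst (word_deg w)"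
  "snd (word_deg (F j # w)) = Suc (snd (word_deg w))"
  "fst (word_deg (w @ z)) = fst (word_deg w) + fst (word_deg z)"
  "snd (word_deg (w @ z)) = snd (word_deg w) + snd (word_deg z)"
  by (auto simp: word_deg_def)

lemma word_deg_map_E [simp]: "word_deg (map E u) = (length u, 0)"
  by (induction u) (auto simp: word_deg_def)

lemma word_deg_map_F [simp]: "word_deg (map F v) = (0, length v)"
  by (induction v) (auto simp: word_deg_def)

lemma finite_words: "finite (words m k)"
  using finite_lists_length_eq[of "{1..m}" k] by (simp add: words_def)

lemma card_words: "card (words m k) = m ^ k"
  using card_lists_length_eq[of "{1..m}" k] by (simp add: words_def)

lemma replicate_in_words: "m \<ge> 1 \<Longrightarrow> replicate k 1 \<in> words m k"
  by (auto simp: words_def)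

locale permutation_semigroup =
  fixes m n :: nat and \<theta> :: "nat \<times> nat \<Rightarrow> nat \<times> nat"
  assumes perm: "\<theta> permutes ({1..m} \<times> {1..n})"
    and m_pos: "m \<ge> 1" and n_pos: "n \<ge> 1"
begin

abbreviation congruent_words :: "letter list \<Rightarrow> letter list \<Rightarrow> bool" (infix "\<approx>" 50) where
  "w \<approx> z \<equiv> (w, z) \<in> F_cong m n \<theta>"

abbreviation letter_words :: "letter list set" where
  "letter_words \<equiv> lists (alphabet m n)"

lemmas cong_trans [trans] = F_cong.trans

lemma cong_left: "w \<approx> z \<Longrightarrow> x \<in> letter_words \<Longrightarrow> x @ w \<approx> x @ z"
  by (intro F_cong.append F_cong.refl)

lemma cong_right: "w \<approx> z \<Longrightarrow> x \<in> letter_words \<Longrightarrow> w @ x \<approx> z @ x"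
  by (intro F_cong.append F_cong.refl)

lemma cong_Cons: "w \<approx> z \<Longrightarrow> c \<in> alphabet m n \<Longrightarrow> c # w \<approx> c # z"
  using cong_left[of w z "[c]"] by simp

section \<open>Normal forms and cancellation\<close>

text \<open>\<open>push j u\<close> carries the letter \<open>f\<^sub>j\<close> from the left of \<open>e\<^sub>u\<close> to its right, one relation at a
  time: if \<open>push j u = (u', j')\<close>, then \<open>f\<^sub>j e\<^sub>u = e\<^bsub>u'\<^esub> f\<^bsub>j'\<^esub>\<close> in the semigroup.\<close>

fun push :: "nat \<Rightarrow> nat list \<Rightarrow> nat list \<times> nat" where
  "push j [] = ([], j)"
| "push j (i # u) =
    (case inv_into UNIV \<theta> (i, j) of (i', j') \<Rightarrow> case push j' u of (u', j'') \<Rightarrow> (i' # u', j''))"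

text \<open>Left multiplication by a letter on the set of normal forms \<open>e\<^sub>u f\<^sub>v\<close>, coded as pairs
  \<open>(u, v)\<close>.\<close>

fun act :: "letter \<Rightarrow> nat list \<times> nat list \<Rightarrow> nat list \<times> nat list" where
  "act (E i) (u, v) = (i # u, v)"
| "act (F j) (u, v) = (case push j u of (u', j') \<Rightarrow> (u', j' # v))"

text \<open>The defining relations hold for the operators \<open>act\<close>, so the semigroup acts on the set of
  pairs. Letting an element act on the empty pair recovers its normal form, and this is
  why no two different normal forms can be identified by the relations.\<close>

lemma foldr_act_cong: "w \<approx> z \<Longrightarrow> foldr act w = foldr act z"
proof (induction rule: F_cong.induct)
  case (comm i j i' j')
  have inv: "inv_into UNIV \<theta> (i', j') = (i, j)"
    using comm(3) permutes_inj[OF perm] by (metis inv_f_f)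
  show ?case
    by (rule ext) (auto simp: inv split: prod.splits)
qed auto

lemma foldr_act_normal_form: "foldr act (map E u @ map F v) ([], []) = (u, v)"
proof -
  have "foldr act (map F v) ([], []) = ([], v)"
    by (induction v) auto
  moreover have "foldr act (map E u) ([], v) = (u, v)"
    by (induction u) auto
  ultimately show ?thesis
    by simp
qed

lemma EF_unique:
  assumes "map E u @ map F v \<approx> map E u' @ map F v'"
  shows "u = u'" "v = v'"
  using foldr_act_cong[OF assms] foldr_act_normal_form by (metis prod.inject)+

text \<open>Bubble sort: if every letter of \<open>Y\<close> can be moved to the right of every letter of \<open>X\<close>, all
  letters of \<open>X\<close> can be collected on the left. It is used with \<open>X\<close> the \<open>e\<close>'s and
  \<open>Y\<close> the \<open>f\<close>'s, and the other way round.\<close>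

lemma sort_letters:
  assumes XY: "alphabet m n = X \<union> Y"
    and swap: "\<And>x y. x \<in> X \<Longrightarrow> y \<in> Y \<Longrightarrow> \<exists>x'\<in>X. \<exists>y'\<in>Y. [y, x] \<approx> [x', y']"
    and "w \<in> letter_words"
  shows "\<exists>p\<in>lists X. \<exists>q\<in>lists Y. w \<approx> p @ q"
  using assms(3)
proof (induction w rule: list.induct)
  case Nil
  then show ?case
    using F_cong.refl[of "[]"] by (metis append_Nil lists.Nil)
next
  case (Cons c w)
  have move: "\<exists>p'\<in>lists X. \<exists>y'\<in>Y. y # p \<approx> p' @ [y']" if "p \<in> lists X" "y \<in> Y" for p y
    using that
  proof (induction p arbitrary: y rule: list.induct)
    case Nil
    then show ?case
      using F_cong.refl[of "[y]"] XY by (intro bexI[of _ "[]"] bexI[of _ y]) auto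
  next
    case (Cons x p)
    obtain x' y' where 1: "x' \<in> X" "y' \<in> Y" "[y, x] \<approx> [x', y']"
      using swap[of x y] Cons.prems by auto
    obtain p' y'' where 2: "p' \<in> lists X" "y'' \<in> Y" "y' # p \<approx> p' @ [y'']"
      using Cons.IH[of y'] Cons.prems 1 by auto
    have "p \<in> letter_words"
      using Cons.prems XY by auto
    then have "y # x # p \<approx> x' # y' # p"
      using cong_right[OF 1(3)] by simp
    also have "x' # y' # p \<approx> x' # p' @ [y'']"
      using cong_Cons[OF 2(3)] 1 XY by simp
    finally show ?case
      using 1 2 by (intro bexI[of _ "x' # p'"] bexI[of _ y'']) auto
  qed
  obtain p q where pq: "p \<in> lists X" "q \<in> lists Y" "w \<approx> p @ q"
    using Cons by auto
  have c: "c # w \<approx> c # p @ q"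
    using Cons.prems cong_Cons[OF pq(3)] by simp
  show ?case
  proof (cases "c \<in> X")
    case True
    then show ?thesis
      using c pq by (intro bexI[of _ "c # p"] bexI[of _ q]) auto
  next
    case False
    then have "c \<in> Y"
      using Cons.prems XY by auto
    then obtain p' y where y: "p' \<in> lists X" "y \<in> Y" "c # p \<approx> p' @ [y]"
      using move pq by blast
    have "q \<in> letter_words"
      using pq XY by auto
    then have "c # w \<approx> p' @ y # q"
      using F_cong.trans[OF c] cong_right[OF y(3)] by simp
    then show ?thesis
      using y pq by (intro bexI[of _ p'] bexI[of _ "y # q"]) auto
  qed
qed

lemma in_lists_image_E: "p \<in> lists (E ` {1..m}) \<Longrightarrow> \<exists>u. set u \<subseteq> {1..m} \<and> p = map E u"
  by (simp add: lists_image image_iff) (metis in_listsD subsetI)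

lemma in_lists_image_F: "q \<in> lists (F ` {1..n}) \<Longrightarrow> \<exists>v. set v \<subseteq> {1..n} \<and> q = map F v"
  by (simp add: lists_image image_iff) (metis in_listsD subsetI)

lemma theta_in_range:
  "i \<in> {1..m} \<Longrightarrow> j \<in> {1..n} \<Longrightarrow> \<theta> (i, j) \<in> {1..m} \<times> {1..n}"
  using permutes_in_image[OF perm, of "(i, j)"] by auto

lemma EF_form:
  assumes "w \<in> letter_words"
  shows "\<exists>u v. set u \<subseteq> {1..m} \<and> set v \<subseteq> {1..n} \<and> w \<approx> map E u @ map F v"
proof -
  have swap: "\<exists>x'\<in>E ` {1..m}. \<exists>y'\<in>F ` {1..n}. [y, x] \<approx> [x', y']"
    if xy: "x \<in> E ` {1..m}" "y \<in> F ` {1..n}" for x y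
  proof -
    obtain i j where ij: "x = E i" "y = F j" "i \<in> {1..m}" "j \<in> {1..n}"
      using xy by blast
    obtain k l where kl: "inv_into UNIV \<theta> (i, j) = (k, l)"
      by fastforce
    have th: "\<theta> (k, l) = (i, j)"
      using kl permutes_inverses(1)[OF perm] by metis
    have "(k, l) \<in> {1..m} \<times> {1..n}"
      using permutes_in_image[OF perm, of "(k, l)"] th ij by auto
    then have "[y, x] \<approx> [E k, F l]" "k \<in> {1..m}" "l \<in> {1..n}"
      using ij F_cong.sym[OF F_cong.comm[of k m l n \<theta> i j]] th by auto
    then show ?thesis
      by blast
  qed
  obtain p q where "p \<in> lists (E ` {1..m})" "q \<in> lists (F ` {1..n})" "w \<approx> p @ q"
    using sort_letters[OF alphabet_def swap assms] by blast
  then show ?thesis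
    using in_lists_image_E in_lists_image_F by metis
qed

lemma FE_form:
  assumes "w \<in> letter_words"
  shows "\<exists>v u. set v \<subseteq> {1..n} \<and> set u \<subseteq> {1..m} \<and> w \<approx> map F v @ map E u"
proof -
  have swap: "\<exists>x'\<in>F ` {1..n}. \<exists>y'\<in>E ` {1..m}. [y, x] \<approx> [x', y']"
    if xy: "x \<in> F ` {1..n}" "y \<in> E ` {1..m}" for x y
  proof -
    obtain i j where ij: "y = E i" "x = F j" "i \<in> {1..m}" "j \<in> {1..n}"
      using xy by blast
    obtain k l where kl: "\<theta> (i, j) = (k, l)"
      by fastforce
    then have "[y, x] \<approx> [F l, E k]" "k \<in> {1..m}" "l \<in> {1..n}"
      using ij F_cong.comm[of i m j n \<theta> k l] theta_in_range[OF ij(3,4)] by auto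
    then show ?thesis
      by blast
  qed
  have "alphabet m n = F ` {1..n} \<union> E ` {1..m}"
    by (auto simp: alphabet_def)
  from sort_letters[OF this swap assms]
  obtain p q where "p \<in> lists (F ` {1..n})" "q \<in> lists (E ` {1..m})" "w \<approx> p @ q"
    by blast
  then show ?thesis
    using in_lists_image_E in_lists_image_F by metis
qed

lemma FE_commute:
  assumes "v \<in> words n l" "u \<in> words m k"
  shows "\<exists>u'\<in>words m k. \<exists>v'\<in>words n l. map E u' @ map F v' \<approx> map F v @ map E u"
proof -
  obtain u' v' where *: "set u' \<subseteq> {1..m}" "set v' \<subseteq> {1..n}"
    "map F v @ map E u \<approx> map E u' @ map F v'"
    using EF_form[of "map F v @ map E u"] assms by (auto simp: words_def)
  have "length u' = k" "length v' = l"
    using arg_cong[OF F_cong_word_deg[OF *(3)], of fst]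
      arg_cong[OF F_cong_word_deg[OF *(3)], of snd] assms by (auto simp: words_def)
  then show ?thesis
    using *(1,2) F_cong.sym[OF *(3)] by (auto simp: words_def)
qed

lemma EF_commute:
  assumes "u \<in> words m k" "v \<in> words n l"
  shows "\<exists>v'\<in>words n l. \<exists>u'\<in>words m k. map E u @ map F v \<approx> map F v' @ map E u'"
proof -
  obtain v' u' where *: "set v' \<subseteq> {1..n}" "set u' \<subseteq> {1..m}"
    "map E u @ map F v \<approx> map F v' @ map E u'"
    using FE_form[of "map E u @ map F v"] assms by (auto simp: words_def)
  have "length u' = k" "length v' = l"
    using arg_cong[OF F_cong_word_deg[OF *(3)], of fst]
      arg_cong[OF F_cong_word_deg[OF *(3)], of snd] assms by (auto simp: words_def)
  then show ?thesis
    using * by (auto simp: words_def)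
qed

text \<open>Rewriting \<open>f\<^sub>v e\<^sub>u\<close> as \<open>e\<^bsub>u'\<^esub> f\<^bsub>v'\<^esub>\<close> maps the finite set of pairs of words of given
  lengths onto itself, hence is injective: the opposite normal form is unique as well.\<close>

lemma FE_unique:
  assumes c: "map F v @ map E u \<approx> map F v' @ map E u'"
  shows "v = v'" "u = u'"
proof -
  define A where "A = words n (length v) \<times> words m (length u)"
  define nf where "nf = (\<lambda>(v, u). prod.swap (foldr act (map F v @ map E u) ([], [])))"
  have "(v, u) \<in> A"
    using F_cong_lists[OF c] by (auto simp: A_def words_def)
  moreover have "(v', u') \<in> A"
    using F_cong_lists[OF c] arg_cong[OF F_cong_word_deg[OF c], of fst]
      arg_cong[OF F_cong_word_deg[OF c], of snd] by (auto simp: A_def words_def)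
  moreover have "nf (v, u) = nf (v', u')"
    using foldr_act_cong[OF c] by (simp only: nf_def prod.case)
  moreover have "inj_on nf A"
  proof (rule finite_surj_inj)
    show "finite A"
      by (simp add: A_def finite_words)
    show "A \<subseteq> nf ` A"
    proof
      fix x assume "x \<in> A"
      then obtain q p where x: "x = (q, p)" "q \<in> words n (length v)" "p \<in> words m (length u)"
        by (auto simp: A_def)
      obtain q' p' where *: "q' \<in> words n (length v)" "p' \<in> words m (length u)"
        "map E p @ map F q \<approx> map F q' @ map E p'"
        using EF_commute[OF x(3,2)] by blast
      have "nf (q', p') = x"
        using foldr_act_normal_form[of p q] foldr_act_cong[OF *(3)] x(1)
        by (simp add: nf_def)
      then show "x \<in> nf ` A"
        using * by (auto simp: A_def image_iff intro: bexI[of _ "(q', p')"])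
    qed
  qed
  ultimately show "v = v'" "u = u'"
    by (auto dest: inj_onD)
qed

lemma E_cancel:
  assumes c: "map E u @ x \<approx> map E u' @ x'" and len: "length u = length u'"
  shows "u = u'" "x \<approx> x'"
proof -
  have v: "map E u \<in> letter_words" "map E u' \<in> letter_words"
    "x \<in> letter_words" "x' \<in> letter_words"
    using F_cong_lists[OF c] by auto
  obtain p q where pq: "x \<approx> map E p @ map F q"
    using EF_form[OF v(3)] by blast
  obtain p' q' where pq': "x' \<approx> map E p' @ map F q'"
    using EF_form[OF v(4)] by blast
  have "map E (u @ p) @ map F q \<approx> map E u @ x"
    using cong_left[OF pq v(1)] F_cong.sym by simp
  also note c
  also have "map E u' @ x' \<approx> map E (u' @ p') @ map F q'"
    using cong_left[OF pq' v(2)] by simp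
  finally have "map E (u @ p) @ map F q \<approx> map E (u' @ p') @ map F q'" .
  note * = EF_unique[OF this]
  show "u = u'"
    using *(1) len by simp
  show "x \<approx> x'"
    using * len F_cong.trans[OF pq] F_cong.sym[OF pq'] by simp
qed

lemma F_cancel:
  assumes c: "map F v @ x \<approx> map F v' @ x'" and len: "length v = length v'"
  shows "v = v'" "x \<approx> x'"
proof -
  have v: "map F v \<in> letter_words" "map F v' \<in> letter_words"
    "x \<in> letter_words" "x' \<in> letter_words"
    using F_cong_lists[OF c] by auto
  obtain q p where pq: "x \<approx> map F q @ map E p"
    using FE_form[OF v(3)] by blast
  obtain q' p' where pq': "x' \<approx> map F q' @ map E p'"
    using FE_form[OF v(4)] by blast
  have "map F (v @ q) @ map E p \<approx> map F v @ x"
    using cong_left[OF pq v(1)] F_cong.sym by simp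
  also note c
  also have "map F v' @ x' \<approx> map F (v' @ q') @ map E p'"
    using cong_left[OF pq' v(2)] by simp
  finally have "map F (v @ q) @ map E p \<approx> map F (v' @ q') @ map E p'" .
  note * = FE_unique[OF this]
  show "v = v'"
    using *(1) len by simp
  show "x \<approx> x'"
    using * len F_cong.trans[OF pq] F_cong.sym[OF pq'] by simp
qed

lemma cancel_left:
  assumes c: "w @ x \<approx> w' @ x'" and deg: "word_deg w = word_deg w'"
  shows "x \<approx> x'"
proof -
  have v: "w \<in> letter_words" "w' \<in> letter_words" "x \<in> letter_words" "x' \<in> letter_words"
    using F_cong_lists[OF c] by auto
  obtain p q where pq: "w \<approx> map E p @ map F q"
    using EF_form[OF v(1)] by blast
  obtain p' q' where pq': "w' \<approx> map E p' @ map F q'"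
    using EF_form[OF v(2)] by blast
  have len: "length p = length p'" "length q = length q'"
    using arg_cong[OF F_cong_word_deg[OF pq], of fst] arg_cong[OF F_cong_word_deg[OF pq'], of fst]
      arg_cong[OF F_cong_word_deg[OF pq], of snd] arg_cong[OF F_cong_word_deg[OF pq'], of snd] deg
    by simp_all
  have "map E p @ map F q @ x \<approx> w @ x"
    using cong_right[OF pq v(3)] F_cong.sym by simp
  also note c
  also have "w' @ x' \<approx> map E p' @ map F q' @ x'"
    using cong_right[OF pq' v(4)] by simp
  finally show ?thesis
    using E_cancel(2)[OF _ len(1)] F_cancel(2)[OF _ len(2)] by blast
qed

lemma factor:
  assumes w: "w \<in> letter_words" and k: "k \<le> fst (word_deg w)" and l: "l \<le> snd (word_deg w)"
  shows "\<exists>u v x. u \<in> words m k \<and> v \<in> words n l \<and> x \<in> letter_words \<and> w \<approx> map E u @ map F v @ x"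
proof -
  obtain p q where pq: "set p \<subseteq> {1..m}" "set q \<subseteq> {1..n}" "w \<approx> map E p @ map F q"
    using EF_form w by blast
  have len: "length p \<ge> k" "length q \<ge> l"
    using k l F_cong_word_deg[OF pq(3)] by auto
  have sub: "set (take k p) \<subseteq> {1..m}" "set (drop k p) \<subseteq> {1..m}"
    using pq(1) set_take_subset[of k p] set_drop_subset[of k p] by blast+
  obtain q' p' where *: "q' \<in> words n (length q)" "p' \<in> words m (length (drop k p))"
    "map E (drop k p) @ map F q \<approx> map F q' @ map E p'"
    using EF_commute[of "drop k p" "length (drop k p)" q "length q"] pq sub by (auto simp: words_def)
  have sub': "set (take l q') \<subseteq> {1..n}" "set (drop l q') \<subseteq> {1..n}"
    using *(1) set_take_subset[of l q'] set_drop_subset[of l q'] by (auto simp: words_def)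
  have "w \<approx> map E (take k p) @ map E (drop k p) @ map F q"
    using pq(3) by (metis append_assoc append_take_drop_id map_append)
  also have "map E (take k p) @ map E (drop k p) @ map F q \<approx> map E (take k p) @ map F q' @ map E p'"
    using cong_left[OF *(3)] sub by simp
  finally have "w \<approx> map E (take k p) @ map F q' @ map E p'" .
  moreover have "map F q' = map F (take l q') @ map F (drop l q')"
    by (metis append_take_drop_id map_append)
  ultimately have "w \<approx> map E (take k p) @ map F (take l q') @ (map F (drop l q') @ map E p')"
    by simp
  moreover have "take k p \<in> words m k" "take l q' \<in> words n l"
    "map F (drop l q') @ map E p' \<in> letter_words"
    using len sub sub' *(1,2) by (auto simp: words_def)
  ultimately show ?thesis
    by blast
qed

section \<open>Elements of the semigroup and words\<close>

lemma F_class_eq_iff: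
  "w \<in> letter_words \<Longrightarrow> z \<in> letter_words \<Longrightarrow> F_class m n \<theta> w = F_class m n \<theta> z \<longleftrightarrow> w \<approx> z"
  unfolding F_class_def by (rule eq_equiv_class_iff[OF F_cong_equiv])

lemma carrier_iff:
  "A \<in> carrier (F_semigroup m n \<theta>) \<longleftrightarrow> (\<exists>w\<in>letter_words. A = F_class m n \<theta> w)"
  by (auto simp: F_semigroup_def quotient_def F_class_def)

lemma elt_deg_F_class:
  assumes "w \<in> letter_words"
  shows "elt_deg (F_class m n \<theta> w) = word_deg w"
proof -
  have "word_deg ` F_class m n \<theta> w = {word_deg w}"
    using F_cong.refl[OF assms] F_cong_word_deg by (fastforce simp: F_class_def)
  then show ?thesis
    by (simp add: elt_deg_def)
qed

lemma commutation_iff: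
  assumes "set u \<subseteq> {1..m}" "set u' \<subseteq> {1..m}" "set v \<subseteq> {1..n}" "set v' \<subseteq> {1..n}"
  shows "e_elt m n \<theta> u \<otimes>\<^bsub>F_semigroup m n \<theta>\<^esub> f_elt m n \<theta> v =
      f_elt m n \<theta> v' \<otimes>\<^bsub>F_semigroup m n \<theta>\<^esub> e_elt m n \<theta> u' \<longleftrightarrow>
    map E u @ map F v \<approx> map F v' @ map E u'"
  using assms by (simp add: e_elt_def f_elt_def F_class_mult F_class_eq_iff)

section \<open>Labels of tails\<close>

definition tail_word :: "(nat \<Rightarrow> nat) \<Rightarrow> (nat \<Rightarrow> nat) \<Rightarrow> nat \<Rightarrow> letter list" where
  "tail_word I J N = concat (map (\<lambda>k. [E (I k), F (J k)]) [0..<N])"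

lemma tail_prefix_eq: "tail_prefix m n \<theta> I J N = F_class m n \<theta> (tail_word I J N)"
  by (simp add: tail_prefix_def tail_word_def)

lemma tail_word_lists: "is_tail m n I J \<Longrightarrow> tail_word I J N \<in> letter_words"
  by (auto simp: tail_word_def is_tail_def)

lemma word_deg_tail_word: "word_deg (tail_word I J N) = (N, N)"
  by (induction N) (auto simp: tail_word_def prod_eq_iff)

lemma tail_word_mono: 
  assumes "is_tail m n I J" "N \<le> N'" 
  shows "\<exists>r\<in>letter_words. tail_word I J N' = tail_word I J N @ r"
  using assms(2)
proof (induction rule: dec_induct)
  case (step k)
  then obtain r where "r \<in> letter_words" "tail_word I J k = tail_word I J N @ r"
    by blast
  then show ?case
    using assms(1) by (intro bexI[of _ "r @ [E (I k), F (J k)]"]) (auto simp: tail_word_def is_tail_def)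
qed (auto intro!: bexI[of _ "[]"])

text \<open>The first letters after a prefix of given degree do not depend on any of the choices made in
  computing them: words that represent the remainders of two tail prefixes become congruent when
  the shorter one is continued along the tail, and cancellation applies.\<close>

lemma label_unique:
  assumes tail: "is_tail m n I J"
    and 1: "tail_word I J N \<approx> w @ x" and 2: "tail_word I J N' \<approx> w' @ x'"
    and deg: "word_deg w = word_deg w'"
  shows "x \<approx> E i # y \<Longrightarrow> x' \<approx> E i' # y' \<Longrightarrow> i = i'"
    and "x \<approx> F j # z \<Longrightarrow> x' \<approx> F j' # z' \<Longrightarrow> j = j'"
proof -
  obtain r r' where r: "r \<in> letter_words" "r' \<in> letter_words"
    "tail_word I J N @ r = tail_word I J N' @ r'"
  proof (cases "N \<le> N'")
    case True
    then show ?thesis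
      using tail_word_mono[OF tail True] that by (metis append_Nil2 lists.Nil)
  next
    case False
    then show ?thesis
      using tail_word_mono[OF tail, of N' N] that by (metis append_Nil2 lists.Nil nat_le_linear)
  qed
  have "w @ x @ r \<approx> w' @ x' @ r'"
    using F_cong.trans[OF F_cong.sym[OF cong_right[OF 1 r(1)]]] cong_right[OF 2 r(2)] r(3) by simp
  then have eq: "x @ r \<approx> x' @ r'"
    using cancel_left deg by blast
  show "i = i'" if "x \<approx> E i # y" "x' \<approx> E i' # y'"
  proof -
    have "map E [i] @ y @ r \<approx> map E [i'] @ y' @ r'"
      using F_cong.trans[OF F_cong.sym[OF cong_right[OF that(1) r(1)]] F_cong.trans[OF eq
        cong_right[OF that(2) r(2)]]]
      by simp
    then show ?thesis
      using E_cancel(1)[of "[i]" _ "[i']"] by simp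
  qed
  show "j = j'" if "x \<approx> F j # z" "x' \<approx> F j' # z'"
  proof -
    have "map F [j] @ z @ r \<approx> map F [j'] @ z' @ r'"
      using F_cong.trans[OF F_cong.sym[OF cong_right[OF that(1) r(1)]] F_cong.trans[OF eq
        cong_right[OF that(2) r(2)]]]
      by simp
    then show ?thesis
      using F_cancel(1)[of "[j]" _ "[j']"] by simp
  qed
qed

lemma tail_label_eq:
  assumes tail: "is_tail m n I J" and N: "int N > max \<bar>s\<bar> \<bar>t\<bar>"
    and c: "tail_word I J N \<approx> w @ x" and deg: "word_deg w = (nat \<bar>s\<bar>, nat \<bar>t\<bar>)"
    and i: "x \<approx> E i # y" and j: "x \<approx> F j # z"
  shows "tail_label m n \<theta> I J s t = (i, j)"
  unfolding tail_label_def
proof (rule the_equality, goal_cases)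
  case 1
  have v: "w \<in> letter_words" "x \<in> letter_words" "y \<in> letter_words" "z \<in> letter_words"
    "i \<in> {1..m}" "j \<in> {1..n}"
    using F_cong_lists[OF c] F_cong_lists[OF i] F_cong_lists[OF j] by auto
  show ?case
    unfolding prod.case
  proof (intro conjI exI bexI)
    show "tail_prefix m n \<theta> I J N =
        F_class m n \<theta> w \<otimes>\<^bsub>F_semigroup m n \<theta>\<^esub> F_class m n \<theta> x"
      using v c tail_word_lists[OF tail] by (simp add: tail_prefix_eq F_class_mult F_class_eq_iff)
    show "F_class m n \<theta> x = e_elt m n \<theta> [i] \<otimes>\<^bsub>F_semigroup m n \<theta>\<^esub> F_class m n \<theta> y"
      using v i by (simp add: e_elt_def F_class_mult F_class_eq_iff)
    show "F_class m n \<theta> x = f_elt m n \<theta> [j] \<otimes>\<^bsub>F_semigroup m n \<theta>\<^esub> F_class m n \<theta> z"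
      using v j by (simp add: f_elt_def F_class_mult F_class_eq_iff)
    show "elt_deg (F_class m n \<theta> w) = (nat \<bar>s\<bar>, nat \<bar>t\<bar>)"
      using v deg by (simp add: elt_deg_F_class)
  qed (use N v carrier_iff in auto)
next
  case (2 ij)
  obtain i' j' where ij: "ij = (i', j')"
    by fastforce
  from 2 obtain N' A B C D where ij': "i' \<in> {1..m}" "j' \<in> {1..n}"
    and car: "A \<in> carrier (F_semigroup m n \<theta>)" "B \<in> carrier (F_semigroup m n \<theta>)"
      "C \<in> carrier (F_semigroup m n \<theta>)" "D \<in> carrier (F_semigroup m n \<theta>)"
    and eqs: "tail_prefix m n \<theta> I J N' = A \<otimes>\<^bsub>F_semigroup m n \<theta>\<^esub> B"
      "elt_deg A = (nat \<bar>s\<bar>, nat \<bar>t\<bar>)"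
      "B = e_elt m n \<theta> [i'] \<otimes>\<^bsub>F_semigroup m n \<theta>\<^esub> C"
      "B = f_elt m n \<theta> [j'] \<otimes>\<^bsub>F_semigroup m n \<theta>\<^esub> D"
    unfolding ij prod.case by blast
  obtain w' x' y' z' where
    w: "w' \<in> letter_words" "x' \<in> letter_words" "y' \<in> letter_words" "z' \<in> letter_words"
      "A = F_class m n \<theta> w'" "B = F_class m n \<theta> x'" "C = F_class m n \<theta> y'" "D = F_class m n \<theta> z'"
    using car by (auto simp: carrier_iff)
  have c': "tail_word I J N' \<approx> w' @ x'"
    using eqs(1) w tail_word_lists[OF tail] by (simp add: tail_prefix_eq F_class_mult F_class_eq_iff)
  have deg': "word_deg w = word_deg w'"
    using eqs(2) w deg by (simp add: elt_deg_F_class)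
  have "x' \<approx> E i' # y'"
    using eqs(3) w ij' by (simp add: e_elt_def F_class_mult F_class_eq_iff)
  moreover have "x' \<approx> F j' # z'"
    using eqs(4) w ij' by (simp add: f_elt_def F_class_mult F_class_eq_iff)
  ultimately show "ij = (i, j)"
    using label_unique[OF tail c c' deg'] i j ij by blast
qed

lemma first_letters:
  assumes "x \<in> letter_words" "fst (word_deg x) > 0" "snd (word_deg x) > 0"
  shows "\<exists>i y. x \<approx> E i # y" "\<exists>j z. x \<approx> F j # z"
proof -
  obtain u v y where "u \<in> words m 1" "x \<approx> map E u @ map F v @ y"
    using factor[of x 1 0] assms by auto
  moreover from this obtain i where "u = [i]"
    by (auto simp: words_def length_Suc_conv)
  ultimately show "\<exists>i y. x \<approx> E i # y"
    by auto
  obtain u v y where "u \<in> words m 0" "v \<in> words n 1" "x \<approx> map E u @ map F v @ y"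
    using factor[of x 0 1] assms by auto
  moreover from this obtain j where "u = []" "v = [j]"
    by (auto simp: words_def length_Suc_conv)
  ultimately show "\<exists>j z. x \<approx> F j # z"
    by auto
qed

lemma
  assumes tail: "is_tail m n I J" and N: "N > k" "N > l"
    and c: "tail_word I J N \<approx> w @ x" and deg: "word_deg w = (k, l)"
  shows fst_tail_label: "x \<approx> E i # y \<Longrightarrow> fst (tail_label m n \<theta> I J (- int k) (- int l)) = i"
    and snd_tail_label: "x \<approx> F j # z \<Longrightarrow> snd (tail_label m n \<theta> I J (- int k) (- int l)) = j"
proof -
  have "fst (word_deg x) > 0" "snd (word_deg x) > 0" "x \<in> letter_words"
    using F_cong_word_deg[OF c] F_cong_lists[OF c] N deg word_deg_tail_word[of I J N]
    by (auto simp: prod_eq_iff)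
  then obtain i' y' j' z' where ij: "x \<approx> E i' # y'" "x \<approx> F j' # z'"
    using first_letters by metis
  have lab: "tail_label m n \<theta> I J (- int k) (- int l) = (i', j')"
    using tail_label_eq[OF tail _ c _ ij] N deg by simp
  show "fst (tail_label m n \<theta> I J (- int k) (- int l)) = i" if "x \<approx> E i # y"
    using lab label_unique(1)[OF tail c c _ that ij(1)] by simp
  show "snd (tail_label m n \<theta> I J (- int k) (- int l)) = j" if "x \<approx> F j # z"
    using lab label_unique(2)[OF tail c c _ that ij(2)] by simp
qed

lemma square_word_is_tail_word:
  assumes "x \<in> letter_words" "word_deg x = (N, N)"
  shows "\<exists>I J. is_tail m n I J \<and> tail_word I J N \<approx> x"
  using assms
proof (induction N arbitrary: x)
  case 0
  then have "x = []"
    by (cases x rule: list.exhaust; cases "hd x") (auto simp: prod_eq_iff)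
  then show ?case
    using m_pos n_pos F_cong.refl[of "[]"]
    by (intro exI[of _ "\<lambda>_. 1"]) (auto simp: is_tail_def tail_word_def)
next
  case (Suc N)
  obtain u v y where f: "u \<in> words m 1" "v \<in> words n 1" "y \<in> letter_words"
    "x \<approx> map E u @ map F v @ y"
    using factor[of x 1 1] Suc.prems by auto
  then obtain i j where ij: "u = [i]" "v = [j]" "i \<in> {1..m}" "j \<in> {1..n}"
    by (auto simp: words_def length_Suc_conv)
  have "word_deg y = (N, N)"
    using F_cong_word_deg[OF f(4)] Suc.prems ij by (auto simp: prod_eq_iff)
  then obtain I J where IJ: "is_tail m n I J" "tail_word I J N \<approx> y"
    using Suc.IH f(3) by blast
  have "tail_word (case_nat i I) (case_nat j J) (Suc N) = [E i, F j] @ tail_word I J N"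
    unfolding tail_word_def map_upt_Suc by simp
  also have "[E i, F j] @ tail_word I J N \<approx> [E i, F j] @ y"
    using cong_left[OF IJ(2), of "[E i, F j]"] ij by simp
  also have "[E i, F j] @ y \<approx> x"
    using f(4) ij F_cong.sym by simp
  finally have "tail_word (case_nat i I) (case_nat j J) (Suc N) \<approx> x" .
  moreover have "is_tail m n (case_nat i I) (case_nat j J)"
    using IJ(1) ij by (auto simp: is_tail_def split: nat.split)
  ultimately show ?case
    by blast
qed

text \<open>Every word begins some tail, so that a property of all tails says something about all
  elements of the semigroup.\<close>

lemma extend_to_tail:
  assumes "w \<in> letter_words"
  shows "\<exists>I J N r. is_tail m n I J \<and> r \<in> letter_words \<and> N > K \<and> tail_word I J N \<approx> w @ r"
proof -
  define N where "N = Suc (K + fst (word_deg w) + snd (word_deg w))"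
  define r where "r = map E (replicate (N - fst (word_deg w)) 1) @
    map F (replicate (N - snd (word_deg w)) 1)"
  have r: "r \<in> letter_words"
    using m_pos n_pos unfolding r_def by (simp del: map_replicate) auto
  have "word_deg (w @ r) = (N, N)"
    by (simp add: prod_eq_iff r_def N_def del: map_replicate)
  then obtain I J where "is_tail m n I J" "tail_word I J N \<approx> w @ r"
    using square_word_is_tail_word[of "w @ r" N] assms r by auto
  moreover have "N > K"
    by (simp add: N_def)
  ultimately show ?thesis
    using r by blast
qed

section \<open>Periodicity and intertwining bijections\<close>

definition intertwines :: "nat \<Rightarrow> nat \<Rightarrow> (nat list \<Rightarrow> nat list) \<Rightarrow> bool" where
  "intertwines a b \<gamma> \<longleftrightarrow> bij_betw \<gamma> (words m a) (words n b) \<and>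
    (\<forall>u\<in>words m a. \<forall>v\<in>words n b.
      map E u @ map F v \<approx> map F (\<gamma> u) @ map E (inv_into (words m a) \<gamma> v))"

lemma tail_periodic_iff:
  "tail_periodic m n \<theta> I J (int a) (- int b) \<longleftrightarrow>
    (\<forall>k l. tail_label m n \<theta> I J (- int k) (- int (l + b)) =
           tail_label m n \<theta> I J (- int (k + a)) (- int l))"
proof
  assume *: "tail_periodic m n \<theta> I J (int a) (- int b)"
  show "\<forall>k l. tail_label m n \<theta> I J (- int k) (- int (l + b)) =
           tail_label m n \<theta> I J (- int (k + a)) (- int l)"
  proof (intro allI)
    fix k l
    show "tail_label m n \<theta> I J (- int k) (- int (l + b)) =
           tail_label m n \<theta> I J (- int (k + a)) (- int l)"
      using *[unfolded tail_periodic_def, rule_format, of "- int (k + a)" "- int l"] by simp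
  qed
next
  assume *: "\<forall>k l. tail_label m n \<theta> I J (- int k) (- int (l + b)) =
           tail_label m n \<theta> I J (- int (k + a)) (- int l)"
  show "tail_periodic m n \<theta> I J (int a) (- int b)"
    unfolding tail_periodic_def
  proof (intro allI impI)
    fix s t :: int
    assume "s \<le> 0 \<and> t \<le> 0 \<and> s + int a \<le> 0 \<and> t + - int b \<le> 0"
    then show "tail_label m n \<theta> I J (s + int a) (t + - int b) = tail_label m n \<theta> I J s t"
      using *[rule_format, of "nat (- s - int a)" "nat (- t)"] by (simp add: algebra_simps)
  qed
qed

text \<open>Periodicity means that removing the prefix of degree \<open>(a, 0)\<close> from a tail and removing the
  prefix of degree \<open>(0, b)\<close> leave remainders with the same letters. Here the remainders \<open>z\<close> and \<open>z'\<close>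
  belong to the word \<open>e\<^sub>u z = f\<^sub>v z'\<close>, which is first continued to a tail; \<open>p\<close> and \<open>q\<close> are then read off
  as labels along two rays of the quadrant that are translates of each other.\<close>

lemma
  assumes per: "F_periodic m n \<theta> (int a) (- int b)"
    and z: "map E u @ z \<approx> map F v @ z'" and len: "length u = a" "length v = b"
    and pq: "length p = length q"
  shows periodic_remainders_F: "z \<approx> map F p @ x \<Longrightarrow> z' \<approx> map F q @ x' \<Longrightarrow> p = q"
    and periodic_remainders_E: "z \<approx> map E p @ x \<Longrightarrow> z' \<approx> map E q @ x' \<Longrightarrow> p = q"
proof -
  have uv: "map E u \<in> letter_words" "map F v \<in> letter_words" "map E u @ z \<in> letter_words"
    using F_cong_lists[OF z] by auto
  obtain I J N r where tail: "is_tail m n I J" "r \<in> letter_words" "N > a + b + length p"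
    "tail_word I J N \<approx> (map E u @ z) @ r"
    using extend_to_tail[OF uv(3)] by blast
  have tail': "tail_word I J N \<approx> (map F v @ z') @ r"
    using F_cong.trans[OF tail(4) cong_right[OF z tail(2)]] .
  have shift: "tail_label m n \<theta> I J (- int k) (- int (l + b)) =
      tail_label m n \<theta> I J (- int (k + a)) (- int l)" for k l
    using per tail(1) by (auto simp: F_periodic_def tail_periodic_iff)
  have step: "tail_word I J N \<approx> w @ y @ y'"
    if "tail_word I J N \<approx> (h @ g) @ r" "g \<approx> e" "h @ e @ r = w @ y @ y'" for h g e w y y'
  proof -
    have "h \<in> letter_words"
      using F_cong_lists[OF that(1)] by simp
    then show ?thesis
      using F_cong.trans[OF that(1) cong_right[OF cong_left[OF that(2)] tail(2)]] that(3) by simp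
  qed
  have split: "map c ps = map c (take k ps) @ c (ps ! k) # map c (drop (Suc k) ps)"
    if "k < length ps" for c :: "nat \<Rightarrow> letter" and ps k
    using id_take_nth_drop[OF that] by (metis list.simps(9) map_append)
  show "p = q" if p: "z \<approx> map F p @ x" and q: "z' \<approx> map F q @ x'"
  proof (rule nth_equalityI[OF pq])
    fix k assume k: "k < length p"
    have "tail_word I J N \<approx>
        (map E u @ map F (take k p)) @ (F (p ! k) # map F (drop (Suc k) p) @ x) @ r"
      by (rule step[OF tail(4) p]) (simp add: split[OF k])
    then have c1: "tail_word I J N \<approx>
        (map E u @ map F (take k p)) @ (F (p ! k) # map F (drop (Suc k) p) @ x @ r)"
      by simp
    have "tail_word I J N \<approx>
        (map F v @ map F (take k q)) @ (F (q ! k) # map F (drop (Suc k) q) @ x') @ r"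
      by (rule step[OF tail' q]) (simp add: split[of k q] k pq[symmetric])
    then have c2: "tail_word I J N \<approx>
        (map F v @ map F (take k q)) @ (F (q ! k) # map F (drop (Suc k) q) @ x' @ r)"
      by simp
    have "snd (tail_label m n \<theta> I J (- int a) (- int k)) = p ! k"
      using k len tail(3) F_cong_lists[OF c1]
      by (intro snd_tail_label[OF tail(1) _ _ c1 _ F_cong.refl]) (auto simp: prod_eq_iff)
    moreover have "snd (tail_label m n \<theta> I J (- int 0) (- int (k + b))) = q ! k"
      using k pq len tail(3) F_cong_lists[OF c2]
      by (intro snd_tail_label[OF tail(1) _ _ c2 _ F_cong.refl]) (auto simp: prod_eq_iff)
    ultimately show "p ! k = q ! k"
      using shift[of 0 k] by simp
  qed
  show "p = q" if p: "z \<approx> map E p @ x" and q: "z' \<approx> map E q @ x'"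
  proof (rule nth_equalityI[OF pq])
    fix k assume k: "k < length p"
    have "tail_word I J N \<approx>
        (map E u @ map E (take k p)) @ (E (p ! k) # map E (drop (Suc k) p) @ x) @ r"
      by (rule step[OF tail(4) p]) (simp add: split[OF k])
    then have c1: "tail_word I J N \<approx>
        (map E u @ map E (take k p)) @ (E (p ! k) # map E (drop (Suc k) p) @ x @ r)"
      by simp
    have "tail_word I J N \<approx>
        (map F v @ map E (take k q)) @ (E (q ! k) # map E (drop (Suc k) q) @ x') @ r"
      by (rule step[OF tail' q]) (simp add: split[of k q] k pq[symmetric])
    then have c2: "tail_word I J N \<approx>
        (map F v @ map E (take k q)) @ (E (q ! k) # map E (drop (Suc k) q) @ x' @ r)"
      by simp
    have "fst (tail_label m n \<theta> I J (- int (k + a)) (- int 0)) = p ! k"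
      using k len tail(3) F_cong_lists[OF c1]
      by (intro fst_tail_label[OF tail(1) _ _ c1 _ F_cong.refl]) (auto simp: prod_eq_iff)
    moreover have "fst (tail_label m n \<theta> I J (- int k) (- int b)) = q ! k"
      using k pq len tail(3) F_cong_lists[OF c2]
      by (intro fst_tail_label[OF tail(1) _ _ c2 _ F_cong.refl]) (auto simp: prod_eq_iff)
    ultimately show "p ! k = q ! k"
      using shift[of k 0] by simp
  qed
qed

text \<open>If \<open>e\<^sub>u f\<^sub>v = f\<^bsub>v'\<^esub> e\<^bsub>u'\<^esub>\<close>, then every continuation \<open>e\<^sub>u f\<^sub>v z = f\<^bsub>v'\<^esub> e\<^bsub>u'\<^esub> z\<close> has the remainders
  \<open>f\<^sub>v z\<close> and \<open>e\<^bsub>u'\<^esub> z\<close>, so \<open>u'\<close> and \<open>v\<close> determine each other: taking \<open>z = f\<^sub>w\<close> and \<open>z = e\<^sub>w\<close> shows that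
  \<open>e\<^bsub>u'\<^esub> f\<^sub>w\<close> always starts with \<open>f\<^sub>v\<close>, and \<open>f\<^sub>v e\<^sub>w\<close> with \<open>e\<^bsub>u'\<^esub>\<close>. Every \<open>u'\<close> arises in this way.\<close>

lemma periodic_imp_intertwines:
  assumes per: "F_periodic m n \<theta> (int a) (- int b)"
  shows "\<exists>\<gamma>. intertwines a b \<gamma>"
proof -
  have F: "p = v"
    if h: "u \<in> words m a" "v \<in> words n b" "v' \<in> words n b" "u' \<in> words m a"
      "w \<in> words n b" "p \<in> words n b"
      "map E u @ map F v \<approx> map F v' @ map E u'" "map E u' @ map F w \<approx> map F p @ map E q"
    for u v v' u' w p q
  proof -
    have fw: "map F w \<in> letter_words" "map F v \<in> letter_words"
      using h(2,5) by (auto simp: words_def)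
    have "map E u @ (map F v @ map F w) \<approx> map F v' @ (map E u' @ map F w)"
      using cong_right[OF h(7) fw(1)] by simp
    moreover have "length u = a" "length v' = b" "length v = length p"
      using h(1-6) by (simp_all add: words_def)
    moreover have "map F v @ map F w \<approx> map F v @ map F w"
      using fw by (intro F_cong.refl) simp
    ultimately have "v = p"
      using h(8) by (rule periodic_remainders_F[OF per, where u = u and v = v' and x = "map F w"])
    then show ?thesis
      by simp
  qed
  have E: "p = u'"
    if h: "u \<in> words m a" "v \<in> words n b" "v' \<in> words n b" "u' \<in> words m a"
      "w \<in> words m a" "p \<in> words m a"
      "map E u @ map F v \<approx> map F v' @ map E u'" "map E p @ map F q \<approx> map F v @ map E w"
    for u v v' u' w p q
  proof -
    have ew: "map E w \<in> letter_words" "map E u' \<in> letter_words"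
      using h(4,5) by (auto simp: words_def)
    have "map E u @ (map F v @ map E w) \<approx> map F v' @ (map E u' @ map E w)"
      using cong_right[OF h(7) ew(1)] by simp
    moreover have "length u = a" "length v' = b" "length p = length u'"
      using h(1-6) by (simp_all add: words_def)
    moreover note F_cong.sym[OF h(8)]
    moreover have "map E u' @ map E w \<approx> map E u' @ map E w"
      using ew by (intro F_cong.refl) simp
    ultimately show ?thesis
      by (rule periodic_remainders_E[OF per, where u = u and v = v' and x = "map F q"
          and x' = "map E w"])
  qed
  define v1 where "v1 = replicate b (1::nat)"
  define u1 where "u1 = replicate a (1::nat)"
  have v1: "v1 \<in> words n b" and u1: "u1 \<in> words m a"
    unfolding v1_def u1_def using replicate_in_words m_pos n_pos by auto
  \<comment> \<open>To find the partner \<open>v\<close> of \<open>u\<close>, put any \<open>f\<close>'s in front of \<open>e\<^sub>u\<close> and rewrite with the \<open>e\<close>'s first.\<close>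
  have "\<forall>u\<in>words m a. \<exists>v. v \<in> words n b \<and> (\<exists>x\<in>words m a. map E x @ map F v \<approx> map F v1 @ map E u)"
    using FE_commute[OF v1] by blast
  then obtain \<gamma> where \<gamma>: "\<And>u. u \<in> words m a \<Longrightarrow>
      \<gamma> u \<in> words n b \<and> (\<exists>x\<in>words m a. map E x @ map F (\<gamma> u) \<approx> map F v1 @ map E u)"
    by metis
  have first: "p = \<gamma> u"
    if "u \<in> words m a" "w \<in> words n b" "p \<in> words n b" "map E u @ map F w \<approx> map F p @ map E q"
    for u w p q
    using \<gamma>[OF that(1)] F[OF _ _ v1 that(1,2,3) _ that(4)] by blast
  have second: "\<gamma> u' = v"
    if h: "u \<in> words m a" "v \<in> words n b" "v' \<in> words n b" "u' \<in> words m a"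
      "map E u @ map F v \<approx> map F v' @ map E u'" for u v v' u'
  proof -
    obtain p q where "p \<in> words n b" "map E u' @ map F v1 \<approx> map F p @ map E q"
      using EF_commute[OF h(4) v1] by blast
    then show ?thesis
      using F[OF h(1-4) v1 _ h(5)] first[OF h(4) v1] by metis
  qed
  have "inj_on \<gamma> (words m a)"
  proof (rule inj_onI)
    fix u u' assume u: "u \<in> words m a" "u' \<in> words m a" "\<gamma> u = \<gamma> u'"
    obtain p q where pq: "p \<in> words m a" "map E p @ map F q \<approx> map F (\<gamma> u) @ map E u1"
      using FE_commute[OF _ u1] \<gamma>[OF u(1)] by blast
    have "p = u"
      using \<gamma>[OF u(1)] E[OF _ _ v1 u(1) u1 pq(1) _ pq(2)] by blast
    moreover have "p = u'"
      using \<gamma>[OF u(2)] E[OF _ _ v1 u(2) u1 pq(1)] pq(2) u(3) by metis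
    ultimately show "u = u'"
      by simp
  qed
  moreover have "\<gamma> ` words m a = words n b"
  proof
    show "words n b \<subseteq> \<gamma> ` words m a"
    proof
      fix v assume v: "v \<in> words n b"
      obtain v' u' where "v' \<in> words n b" "u' \<in> words m a" "map E u1 @ map F v \<approx> map F v' @ map E u'"
        using EF_commute[OF u1 v] by blast
      then show "v \<in> \<gamma> ` words m a"
        using second[OF u1 v] by blast
    qed
  qed (use \<gamma> in blast)
  ultimately have bij: "bij_betw \<gamma> (words m a) (words n b)"
    by (simp add: bij_betw_def)
  have "map E u @ map F v \<approx> map F (\<gamma> u) @ map E (inv_into (words m a) \<gamma> v)"
    if uv: "u \<in> words m a" "v \<in> words n b" for u v
  proof -
    obtain v' u' where *: "v' \<in> words n b" "u' \<in> words m a" "map E u @ map F v \<approx> map F v' @ map E u'"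
      using EF_commute[OF uv] by blast
    have "inv_into (words m a) \<gamma> v = u'"
      using second[OF uv *] bij * by (metis bij_betw_imp_inj_on inv_into_f_eq)
    then show ?thesis
      using * first[OF uv *(1,3)] by simp
  qed
  then show ?thesis
    using bij by (auto simp: intertwines_def)
qed

text \<open>Conversely, let \<open>y = e\<^sub>u f\<^sub>v e\<^bsub>u'\<^esub> f\<^bsub>v'\<^esub> r\<close> be what follows some prefix of a tail. Removing \<open>e\<^sub>u\<close> from \<open>y\<close>
  leaves \<open>f\<^sub>v e\<^bsub>u'\<^esub> \<cdots>\<close>, and removing \<open>f\<^bsub>\<gamma>(u)\<^esub>\<close> leaves \<open>e\<^bsub>x\<^esub> e\<^bsub>u'\<^esub> \<cdots>\<close> with \<open>\<gamma>(x) = v\<close>. Commuting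
  further in each, both remainders start with \<open>e\<^sub>x\<close> and also with \<open>f\<^sub>v\<close>, so they have equal first letters.\<close>

lemma intertwines_imp_periodic:
  assumes int: "intertwines a b \<gamma>" and a: "a > 0" and b: "b > 0"
  shows "F_periodic m n \<theta> (int a) (- int b)"
  unfolding F_periodic_def tail_periodic_iff
proof (intro allI impI)
  fix I J k l assume tail: "is_tail m n I J"
  define ginv where "ginv = inv_into (words m a) \<gamma>"
  have bij: "bij_betw \<gamma> (words m a) (words n b)"
    using int by (simp add: intertwines_def)
  have \<gamma>_in: "\<gamma> u \<in> words n b" if "u \<in> words m a" for u
    using bij that by (auto simp: bij_betw_def)
  have inv_in: "ginv v \<in> words m a" and \<gamma>_inv: "\<gamma> (ginv v) = v" if "v \<in> words n b" for v
    using bij that unfolding ginv_def bij_betw_def by (metis inv_into_into, metis f_inv_into_f)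
  have inv_\<gamma>: "ginv (\<gamma> u) = u" if "u \<in> words m a" for u
    using bij that unfolding ginv_def bij_betw_def by simp
  have comm: "map E u @ map F v \<approx> map F (\<gamma> u) @ map E (ginv v)"
    if "u \<in> words m a" "v \<in> words n b" for u v
    using int that by (simp add: intertwines_def ginv_def)
  have lists: "map E u \<in> letter_words" "map F v \<in> letter_words"
    if "u \<in> words m c" "v \<in> words n d" for u v c d
    using that by (auto simp: words_def)
  define N where "N = k + l + 2 * a + 2 * b"
  obtain p q y where y: "p \<in> words m k" "q \<in> words n l" "y \<in> letter_words"
    "tail_word I J N \<approx> map E p @ map F q @ y"
    using factor[OF tail_word_lists[OF tail, of N], of k l] by (auto simp: word_deg_tail_word N_def)
  have deg_y: "fst (word_deg y) \<ge> 2 * a" "snd (word_deg y) \<ge> 2 * b"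
    using F_cong_word_deg[OF y(4)] y(1,2) word_deg_tail_word[of I J N]
    by (auto simp: N_def prod_eq_iff words_def)
  obtain u v y' where y': "u \<in> words m a" "v \<in> words n b" "y' \<in> letter_words"
    "y \<approx> map E u @ map F v @ y'"
    using factor[OF y(3), of a b] deg_y by auto
  obtain u' v' r where r: "u' \<in> words m a" "v' \<in> words n b" "r \<in> letter_words"
    "y' \<approx> map E u' @ map F v' @ r"
    using factor[OF y'(3), of a b] deg_y F_cong_word_deg[OF y'(4)] y'(1,2)
    by (auto simp: prod_eq_iff words_def)
  define x where "x = ginv v"
  have x: "x \<in> words m a" "\<gamma> x = v"
    using inv_in \<gamma>_inv y'(2) x_def by auto
  define z1 where "z1 = map F v @ map E u' @ map F v' @ r"
  define z2 where "z2 = map E x @ map E u' @ map F v' @ r"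
  have "map E u @ map F v @ y' \<approx> map E u @ z1"
    using cong_left[OF r(4), of "map E u @ map F v"] lists y' unfolding z1_def by simp
  with y'(4) have y1: "y \<approx> map E u @ z1"
    by (rule F_cong.trans)
  have "map E u @ z1 \<approx> map F (\<gamma> u) @ z2"
    using cong_right[OF comm[OF y'(1,2)], of "map E u' @ map F v' @ r"] lists r
    unfolding z1_def z2_def x_def by simp
  with y1 have y2: "y \<approx> map F (\<gamma> u) @ z2"
    by (rule F_cong.trans)
  have z_lists: "z1 \<in> letter_words" "z2 \<in> letter_words"
    using F_cong_lists[OF y1] F_cong_lists[OF y2] by auto
  have z1E: "z1 \<approx> map E x @ map F (\<gamma> u') @ map F v' @ r"
    using cong_right[OF F_cong.sym[OF comm[OF x(1) \<gamma>_in[OF r(1)]]], of "map F v' @ r"] lists r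
      inv_\<gamma>[OF r(1)] x unfolding z1_def by simp
  have "z2 \<approx> map E x @ map F (\<gamma> u') @ map E (ginv v') @ r"
    using cong_left[OF cong_right[OF comm[OF r(1,2)] r(3)], of "map E x"] lists x(1) y'(2)
    unfolding z2_def by simp
  also have "map E x @ map F (\<gamma> u') @ map E (ginv v') @ r \<approx>
      map F v @ map E u' @ map E (ginv v') @ r"
    using cong_right[OF comm[OF x(1) \<gamma>_in[OF r(1)]], of "map E (ginv v') @ r"] lists r
      inv_in[OF r(2)] inv_\<gamma>[OF r(1)] x by simp
  finally have z2F: "z2 \<approx> map F v @ map E u' @ map E (ginv v') @ r" .
  obtain i xs where xs: "x = i # xs"
    using x(1) a by (cases x) (auto simp: words_def)
  obtain j vs where vs: "v = j # vs"
    using y'(2) b by (cases v) (auto simp: words_def)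
  have pq: "map E p @ map F q \<in> letter_words"
    using y lists by auto
  have t1: "tail_word I J N \<approx> (map E p @ map F q @ map E u) @ z1"
    using F_cong.trans[OF y(4)] cong_left[OF y1 pq] by simp
  have t2: "tail_word I J N \<approx> (map E p @ map F q @ map F (\<gamma> u)) @ z2"
    using F_cong.trans[OF y(4)] cong_left[OF y2 pq] by simp
  have "tail_label m n \<theta> I J (- int (k + a)) (- int l) = (i, j)"
  proof (rule tail_label_eq[OF tail _ t1])
    show "z1 \<approx> E i # map E xs @ map F (\<gamma> u') @ map F v' @ r"
      using z1E xs by simp
    show "z1 \<approx> F j # map F vs @ map E u' @ map F v' @ r"
      using F_cong.refl[OF z_lists(1)] vs unfolding z1_def by simp
  qed (use y y'(1) a b in \<open>auto simp: N_def words_def prod_eq_iff\<close>)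
  moreover have "tail_label m n \<theta> I J (- int k) (- int (l + b)) = (i, j)"
  proof (rule tail_label_eq[OF tail _ t2])
    show "z2 \<approx> E i # map E xs @ map E u' @ map F v' @ r"
      using F_cong.refl[OF z_lists(2)] xs unfolding z2_def by simp
    show "z2 \<approx> F j # map F vs @ map E u' @ map E (ginv v') @ r"
      using z2F vs by simp
  qed (use y \<gamma>_in[OF y'(1)] a b in \<open>auto simp: N_def words_def prod_eq_iff\<close>)
  ultimately show "tail_label m n \<theta> I J (- int k) (- int (l + b)) =
      tail_label m n \<theta> I J (- int (k + a)) (- int l)"
    by simp
qed

lemma intertwines_commutation:
  assumes int: "intertwines a b \<gamma>" and u: "u \<in> words m a" and v: "v \<in> words n b"
    and c: "map E u @ map F v \<approx> map F v' @ map E u'"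
  shows "v' = \<gamma> u" "u' \<in> words m a" "\<gamma> u' = v"
proof -
  have bij: "bij_betw \<gamma> (words m a) (words n b)"
    using int by (simp add: intertwines_def)
  have "map F v' @ map E u' \<approx> map F (\<gamma> u) @ map E (inv_into (words m a) \<gamma> v)"
    using F_cong.trans[OF F_cong.sym[OF c]] int u v by (auto simp: intertwines_def)
  note * = FE_unique[OF this]
  show "v' = \<gamma> u"
    by (fact *)
  show "u' \<in> words m a" "\<gamma> u' = v"
    using * bij v by (auto simp: bij_betw_def inv_into_into f_inv_into_f)
qed

lemma assoc_bij_intertwines:
  assumes "intertwines a b \<gamma>"
  shows "intertwines a b (assoc_bij m n \<theta> a b)"
proof -
  let ?P = "\<lambda>\<gamma>. \<gamma> \<in> extensional (words m a) \<and> bij_betw \<gamma> (words m a) (words n b) \<and>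
     (\<forall>u\<in>words m a. \<forall>v\<in>words n b.
        e_elt m n \<theta> u \<otimes>\<^bsub>F_semigroup m n \<theta>\<^esub> f_elt m n \<theta> v =
        f_elt m n \<theta> (\<gamma> u) \<otimes>\<^bsub>F_semigroup m n \<theta>\<^esub> e_elt m n \<theta> (inv_into (words m a) \<gamma> v))"
  have P: "?P \<delta> \<longleftrightarrow> \<delta> \<in> extensional (words m a) \<and> intertwines a b \<delta>" for \<delta>
  proof (cases "bij_betw \<delta> (words m a) (words n b)")
    case True
    have "(e_elt m n \<theta> u \<otimes>\<^bsub>F_semigroup m n \<theta>\<^esub> f_elt m n \<theta> v =
        f_elt m n \<theta> (\<delta> u) \<otimes>\<^bsub>F_semigroup m n \<theta>\<^esub> e_elt m n \<theta> (inv_into (words m a) \<delta> v)) \<longleftrightarrow>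
        map E u @ map F v \<approx> map F (\<delta> u) @ map E (inv_into (words m a) \<delta> v)"
      if uv: "u \<in> words m a" "v \<in> words n b" for u v
    proof (rule commutation_iff)
      have "\<delta> u \<in> words n b" "inv_into (words m a) \<delta> v \<in> words m a"
        using True uv by (auto simp: bij_betw_def inv_into_into)
      then show "set u \<subseteq> {1..m}" "set (inv_into (words m a) \<delta> v) \<subseteq> {1..m}"
        "set v \<subseteq> {1..n}" "set (\<delta> u) \<subseteq> {1..n}"
        using uv by (auto simp: words_def)
    qed
    then show ?thesis
      by (simp add: intertwines_def)
  qed (simp add: intertwines_def)
  let ?\<gamma> = "restrict \<gamma> (words m a)"
  have "inv_into (words m a) ?\<gamma> v = inv_into (words m a) \<gamma> v" for v
    unfolding inv_into_def by (metis restrict_apply')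
  then have "intertwines a b ?\<gamma>"
    using assms by (simp add: intertwines_def cong: bij_betw_cong)
  then have "?P ?\<gamma>"
    unfolding P by simp
  moreover have "\<delta> = ?\<gamma>" if "?P \<delta>" for \<delta>
  proof (rule extensionalityI)
    show "\<delta> \<in> extensional (words m a)"
      using that by blast
    fix u assume u: "u \<in> words m a"
    have v: "replicate b 1 \<in> words n b"
      using replicate_in_words n_pos by simp
    obtain v' u' where "map E u @ map F (replicate b 1) \<approx> map F v' @ map E u'"
      using EF_commute[OF u v] by blast
    then show "\<delta> u = ?\<gamma> u"
      using intertwines_commutation(1)[OF _ u v] that[unfolded P] \<open>intertwines a b ?\<gamma>\<close> by metis
  qed simp
  ultimately have "?P (assoc_bij m n \<theta> a b)"
    unfolding assoc_bij_def by (rule theI)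
  then show ?thesis
    unfolding P by blast
qed

section \<open>Runs\<close>

lemma ef_chain:
  assumes "\<And>k. k < l \<Longrightarrow> map E (us k) @ [F (js k)] \<approx> F (js (Suc k)) # map E (us (Suc k))"
    and "set (us 0) \<subseteq> {1..m}"
  shows "map E (us 0) @ map F (map js [0..<l]) \<approx> map F (map js [1..<l + 1]) @ map E (us l)"
  using assms(1)
proof (induction l)
  case 0
  show ?case
    using F_cong.refl[of "map E (us 0)"] assms(2) by simp
next
  case (Suc l)
  have last: "map E (us l) @ [F (js l)] \<approx> F (js (Suc l)) # map E (us (Suc l))"
    using Suc.prems by simp
  have IH: "map E (us 0) @ map F (map js [0..<l]) \<approx> map F (map js [1..<l + 1]) @ map E (us l)"
    using Suc by simp
  have v: "[F (js l)] \<in> letter_words" "map F (map js [1..<l + 1]) \<in> letter_words"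
    using F_cong_lists[OF last] F_cong_lists[OF IH] by auto
  have "map E (us 0) @ map F (map js [0..<Suc l]) \<approx>
      map F (map js [1..<l + 1]) @ map E (us l) @ [F (js l)]"
    using cong_right[OF IH v(1)] by simp
  also have "map F (map js [1..<l + 1]) @ map E (us l) @ [F (js l)] \<approx>
      map F (map js [1..<l + 1]) @ F (js (Suc l)) # map E (us (Suc l))"
    by (rule cong_left[OF last v(2)])
  finally show ?case
    by simp
qed

text \<open>Moving \<open>f\<^sub>v\<close> to the left across a word of \<open>e\<close>'s meets the last letter first; this
  is why the \<open>i\<^sub>k\<close> appear in reverse order.\<close>

lemma fe_chain:
  assumes "\<And>k. k < l \<Longrightarrow> E (il k) # map F (vs k) \<approx> map F (vs (Suc k)) @ [E (il (Suc k))]"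
    and "set (vs 0) \<subseteq> {1..n}"
  shows "map E (rev (map il [0..<l])) @ map F (vs 0) \<approx>
    map F (vs l) @ map E (rev (map il [1..<l + 1]))"
  using assms(1)
proof (induction l)
  case 0
  show ?case
    using F_cong.refl[of "map F (vs 0)"] assms(2) by simp
next
  case (Suc l)
  have last: "E (il l) # map F (vs l) \<approx> map F (vs (Suc l)) @ [E (il (Suc l))]"
    using Suc.prems by simp
  have IH: "map E (rev (map il [0..<l])) @ map F (vs 0) \<approx>
      map F (vs l) @ map E (rev (map il [1..<l + 1]))"
    using Suc by simp
  have v: "E (il l) \<in> alphabet m n" "map E (rev (map il [1..<l + 1])) \<in> letter_words"
    using F_cong_lists[OF last] F_cong_lists[OF IH] by auto
  have "map E (rev (map il [0..<Suc l])) @ map F (vs 0) \<approx>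
      E (il l) # map F (vs l) @ map E (rev (map il [1..<l + 1]))"
    using cong_Cons[OF IH v(1)] by simp
  also have "E (il l) # map F (vs l) @ map E (rev (map il [1..<l + 1])) \<approx>
      (map F (vs (Suc l)) @ [E (il (Suc l))]) @ map E (rev (map il [1..<l + 1]))"
    using cong_right[OF last v(2)] by simp
  finally show ?case
    by simp
qed

text \<open>The composed relation gives \<open>\<gamma>(u\<^sub>0) = j\<^sub>1 \<cdots> j\<^sub>b\<close> and \<open>\<gamma>(u\<^sub>b) = j\<^sub>0 \<cdots> j\<^bsub>b-1\<^esub>\<close>. With all indices raised by
  one it gives \<open>\<gamma>(u) = j\<^sub>1 \<cdots> j\<^sub>b\<close>, so \<open>u = u\<^sub>0\<close> by injectivity; and \<open>j\<close>, emitted by \<open>e\<^bsub>u\<^sub>b\<^esub>\<close>, is the first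
  letter of \<open>\<gamma>(u\<^sub>b)\<close>.\<close>

lemma ef_run_intertwines:
  assumes int: "intertwines a b \<gamma>" and b: "b > 0"
    and run: "ef_run m n \<theta> a b u\<^sub>0 j\<^sub>0 js us j u"
  shows "\<gamma> u\<^sub>0 = map js [1..<b + 1]" "j = j\<^sub>0" "u = u\<^sub>0"
proof -
  \<comment> \<open>Appending the last pair to the sequences makes the last relation a step like the others.\<close>
  define js' where "js' = js(Suc b := j)"
  define us' where "us' = us(Suc b := u)"
  have us': "us' k \<in> words m a" and js': "js' k \<in> {1..n}" if "k \<le> Suc b" for k
    using run that by (auto simp: ef_run_def us'_def js'_def)
  have eq: "e_elt m n \<theta> (us' k) \<otimes>\<^bsub>F_semigroup m n \<theta>\<^esub> f_elt m n \<theta> [js' k] =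
      f_elt m n \<theta> [js' (Suc k)] \<otimes>\<^bsub>F_semigroup m n \<theta>\<^esub> e_elt m n \<theta> (us' (Suc k))" if "k \<le> b" for k
    using run that unfolding ef_run_def us'_def js'_def by (cases "k = b") auto
  have step: "map E (us' k) @ [F (js' k)] \<approx> F (js' (Suc k)) # map E (us' (Suc k))" if "k \<le> b" for k
    using commutation_iff[of "us' k" "us' (Suc k)" "[js' k]" "[js' (Suc k)]"] eq[OF that]
      us'[of k] us'[of "Suc k"] js'[of k] js'[of "Suc k"] that by (auto simp: words_def)
  have zero: "us' 0 = u\<^sub>0" "js' 0 = j\<^sub>0"
    using run by (auto simp: ef_run_def us'_def js'_def)
  have words: "map js' [0..<b] \<in> words n b" "map js' [1..<b + 1] \<in> words n b"
    using js' by (auto simp: words_def subset_iff)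
  have "map E (us' 0) @ map F (map js' [0..<b]) \<approx> map F (map js' [1..<b + 1]) @ map E (us' b)"
    using us'[of 0] by (intro ef_chain step) (auto simp: words_def)
  note first = intertwines_commutation[OF int us'[of 0] words(1) this]
  have "map E (us' 1) @ map F (map (\<lambda>k. js' (Suc k)) [0..<b]) \<approx>
      map F (map (\<lambda>k. js' (Suc k)) [1..<b + 1]) @ map E (us' (Suc b))"
    using us'[of 1] b ef_chain[of b "\<lambda>k. us' (Suc k)" "\<lambda>k. js' (Suc k)"] step
    by (auto simp: words_def)
  moreover have "map (\<lambda>k. js' (Suc k)) [0..<b] = map js' [1..<b + 1]"
    by (simp add: map_Suc_upt[symmetric] del: upt_Suc)
  ultimately have "map E (us' 1) @ map F (map js' [1..<b + 1]) \<approx>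
      map F (map (\<lambda>k. js' (Suc k)) [1..<b + 1]) @ map E (us' (Suc b))"
    by (simp only:)
  from intertwines_commutation(3)[OF int us'[of 1] words(2) this]
  have "\<gamma> (us' (Suc b)) = map js' [1..<b + 1]"
    by simp
  with first(1) have "us' (Suc b) = us' 0"
    using int us'[of 0] us'[of "Suc b"] by (auto simp: intertwines_def bij_betw_def dest: inj_onD)
  then show "u = u\<^sub>0"
    using zero by (simp add: us'_def)
  show "\<gamma> u\<^sub>0 = map js [1..<b + 1]"
    using first(1) zero by (simp add: js'_def del: upt_Suc)
  \<comment> \<open>Only the first letter of \<open>\<gamma> (u\<^sub>b) = j\<^sub>0 \<cdots> j\<^bsub>b-1\<^esub>\<close> matters, so \<open>f\<^bsub>j\<^sub>b\<^esub>\<close> may be continued by any word.\<close>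
  define w where "w = js' b # replicate (b - 1) 1"
  have w: "w \<in> words n b"
    using js'[of b] b n_pos by (auto simp: w_def words_def)
  have "map F (replicate (b - 1) 1) \<in> letter_words"
    using n_pos by (simp del: map_replicate) auto
  then have emit: "map E (us' b) @ map F w \<approx>
      F (js' (Suc b)) # map E (us' (Suc b)) @ map F (replicate (b - 1) 1)"
    using cong_right[OF step[of b]] by (simp add: w_def)
  obtain v' u' where v'u': "map E (us' b) @ map F w \<approx> map F v' @ map E u'"
    using EF_commute[OF us'[of b] w] by auto
  have "v' = map js' [0..<b]"
    using intertwines_commutation(1)[OF int us'[of b] w v'u'] first(3) by simp
  then have "v' = j\<^sub>0 # map js' [1..<b]"
    using b zero by (simp add: upt_conv_Cons)
  with F_cong.trans[OF F_cong.sym[OF emit] v'u'] have "map F [js' (Suc b)] @ map E (us' (Suc b)) @ map F (replicate (b - 1) 1) \<approx>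
      map F [j\<^sub>0] @ map F (map js' [1..<b]) @ map E u'"
    by simp
  from F_cancel(1)[OF this] have "js' (Suc b) = j\<^sub>0"
    by simp
  then show "j = j\<^sub>0"
    by (simp add: js'_def)
qed

text \<open>The mirror image of the preceding argument: now \<open>\<gamma>\<^sup>-\<^sup>1(v\<^sub>0) = i\<^sub>a \<cdots> i\<^sub>1\<close> and
  \<open>\<gamma>\<^sup>-\<^sup>1(v\<^sub>a) = i\<^bsub>a-1\<^esub> \<cdots> i\<^sub>0\<close>, and the letter that comes out is the last one.\<close>

lemma fe_run_intertwines:
  assumes int: "intertwines a b \<gamma>" and a: "a > 0" and u\<^sub>0: "u\<^sub>0 \<in> words m a"
    and run: "fe_run m n \<theta> a b (\<gamma> u\<^sub>0) i\<^sub>0 il vs i v"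
  shows "rev (map il [1..<a + 1]) = u\<^sub>0" "v = \<gamma> u\<^sub>0" "i = i\<^sub>0"
proof -
  define il' where "il' = il(Suc a := i)"
  define vs' where "vs' = vs(Suc a := v)"
  have vs': "vs' k \<in> words n b" and il': "il' k \<in> {1..m}" if "k \<le> Suc a" for k
    using run that by (auto simp: fe_run_def vs'_def il'_def)
  have eq: "e_elt m n \<theta> [il' k] \<otimes>\<^bsub>F_semigroup m n \<theta>\<^esub> f_elt m n \<theta> (vs' k) =
      f_elt m n \<theta> (vs' (Suc k)) \<otimes>\<^bsub>F_semigroup m n \<theta>\<^esub> e_elt m n \<theta> [il' (Suc k)]" if "k \<le> a" for k
    using run that unfolding fe_run_def vs'_def il'_def by (cases "k = a") auto
  have step: "E (il' k) # map F (vs' k) \<approx> map F (vs' (Suc k)) @ [E (il' (Suc k))]" if "k \<le> a" for k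
    using commutation_iff[of "[il' k]" "[il' (Suc k)]" "vs' k" "vs' (Suc k)"] eq[OF that]
      vs'[of k] vs'[of "Suc k"] il'[of k] il'[of "Suc k"] that by (auto simp: words_def)
  have zero: "vs' 0 = \<gamma> u\<^sub>0" "il' 0 = i\<^sub>0"
    using run by (auto simp: fe_run_def vs'_def il'_def)
  have inj: "x = x'" if "x \<in> words m a" "x' \<in> words m a" "\<gamma> x = \<gamma> x'" for x x'
    using int that by (auto simp: intertwines_def bij_betw_def dest: inj_onD)
  have words: "rev (map il' [0..<a]) \<in> words m a" "rev (map il' [1..<a + 1]) \<in> words m a"
    using il' by (auto simp: words_def subset_iff)
  have "map E (rev (map il' [0..<a])) @ map F (vs' 0) \<approx>
      map F (vs' a) @ map E (rev (map il' [1..<a + 1]))"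
    using vs'[of 0] by (intro fe_chain step) (auto simp: words_def)
  note first = intertwines_commutation[OF int words(1) vs'[of 0] this]
  have u\<^sub>0_eq: "rev (map il' [1..<a + 1]) = u\<^sub>0"
    using inj[OF words(2) u\<^sub>0] first(3) zero by simp
  then show "rev (map il [1..<a + 1]) = u\<^sub>0"
    by (simp add: il'_def del: upt_Suc)
  have "map E (rev (map (\<lambda>k. il' (Suc k)) [0..<a])) @ map F (vs' 1) \<approx>
      map F (vs' (Suc a)) @ map E (rev (map (\<lambda>k. il' (Suc k)) [1..<a + 1]))"
    using vs'[of 1] a fe_chain[of a "\<lambda>k. il' (Suc k)" "\<lambda>k. vs' (Suc k)"] step
    by (auto simp: words_def)
  moreover have "map (\<lambda>k. il' (Suc k)) [0..<a] = map il' [1..<a + 1]"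
    by (simp add: map_Suc_upt[symmetric] del: upt_Suc)
  ultimately have "map E (rev (map il' [1..<a + 1])) @ map F (vs' 1) \<approx>
      map F (vs' (Suc a)) @ map E (rev (map (\<lambda>k. il' (Suc k)) [1..<a + 1]))"
    by (simp only:)
  from intertwines_commutation(1)[OF int words(2) vs'[of 1] this]
  have "vs' (Suc a) = \<gamma> u\<^sub>0"
    unfolding u\<^sub>0_eq by simp
  then show "v = \<gamma> u\<^sub>0"
    by (simp add: vs'_def)
  \<comment> \<open>Only the last letter of \<open>\<gamma>\<^sup>-\<^sup>1 (v\<^sub>a) = i\<^bsub>a-1\<^esub> \<cdots> i\<^sub>0\<close> matters, so any word may precede \<open>e\<^bsub>i\<^sub>a\<^esub>\<close>.\<close>
  define r where "r = replicate (a - 1) (1::nat)"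
  have r: "r \<in> words m (a - 1)"
    unfolding r_def using replicate_in_words m_pos by simp
  then have r_lists: "map E r \<in> letter_words"
    by (auto simp: words_def)
  have w: "r @ [il' a] \<in> words m a"
    using r il'[of a] a by (auto simp: words_def)
  obtain q p where qp: "q \<in> words n b" "map E r @ map F (vs' (Suc a)) \<approx> map F q @ map E p"
    using EF_commute[OF r vs'[of "Suc a"]] by blast
  have "map E (r @ [il' a]) @ map F (vs' a) \<approx> map E r @ map F (vs' (Suc a)) @ [E (il' (Suc a))]"
    using cong_left[OF step[of a] r_lists] by simp
  also have "map E r @ map F (vs' (Suc a)) @ [E (il' (Suc a))] \<approx>
      map F q @ map E (p @ [il' (Suc a)])"
    using cong_right[OF qp(2), of "[E (il' (Suc a))]"] il'[of "Suc a"] by simp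
  finally have "map E (r @ [il' a]) @ map F (vs' a) \<approx> map F q @ map E (p @ [il' (Suc a)])" .
  note last = intertwines_commutation(2,3)[OF int w vs'[of a] this]
  have "p @ [il' (Suc a)] = rev (map il' [0..<a])"
    using inj[OF _ words(1)] last first(1) by simp
  also have "\<dots> = rev (map il' [1..<a]) @ [il' 0]"
    using a by (simp add: upt_conv_Cons)
  finally show "i = i\<^sub>0"
    using zero by (simp add: il'_def)
qed

lemma infinite_run_exists:
  assumes "u\<^sub>0 \<in> words m a" "j\<^sub>0 \<in> {1..n}"
  shows "\<exists>us js. us 0 = u\<^sub>0 \<and> js 0 = j\<^sub>0 \<and> (\<forall>k. us k \<in> words m a \<and> js k \<in> {1..n} \<and>
    map E (us k) @ map F [js k] \<approx> map F [js (Suc k)] @ map E (us (Suc k)))"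
proof -
  let ?P = "\<lambda>(u, j). u \<in> words m a \<and> j \<in> {1..n}"
  let ?Q = "\<lambda>(u, j) (u', j'). map E u @ map F [j] \<approx> map F [j'] @ map E u'"
  have "\<exists>y. ?P y \<and> ?Q x y" if "?P x" for x
  proof -
    obtain u j where "x = (u, j)"
      by fastforce
    with that have x: "x = (u, j)" "u \<in> words m a" "[j] \<in> words n 1"
      by (auto simp: words_def)
    obtain v' u' where *: "v' \<in> words n 1" "u' \<in> words m a"
      "map E u @ map F [j] \<approx> map F v' @ map E u'"
      using EF_commute[OF x(2,3)] by blast
    then obtain j' where "v' = [j']" "j' \<in> {1..n}"
      by (auto simp: words_def length_Suc_conv)
    then show ?thesis
      using * x by (intro exI[of _ "(u', j')"]) simp
  qed
  then obtain g where g: "\<And>x. ?P x \<Longrightarrow> ?P (g x) \<and> ?Q x (g x)"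
    by metis
  define s where "s k = (g ^^ k) (u\<^sub>0, j\<^sub>0)" for k
  have P: "?P (s k)" for k
  proof (induction k)
    case 0
    then show ?case
      using assms by (simp add: s_def)
  next
    case (Suc k)
    then show ?case
      using g[of "s k"] by (simp add: s_def)
  qed
  have "?Q (s k) (s (Suc k))" for k
    using g[OF P[of k]] by (simp add: s_def)
  then show ?thesis
    using P by (intro exI[of _ "\<lambda>k. fst (s k)"] exI[of _ "\<lambda>k. snd (s k)"])
      (auto simp: case_prod_unfold s_def)
qed

text \<open>Continue the run from \<open>u\<^sub>0\<close> and \<open>j\<^sub>0\<close> beyond its end. The segment that begins at
  \<open>u\<^sub>1\<close> and \<open>j\<^sub>1\<close> is again a run; as \<open>j\<^bsub>b+1\<^esub> = j\<^sub>0\<close>, the word of \<open>u\<^sub>1\<close> is that of \<open>u\<^sub>0\<close> with the first letter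
  dropped and \<open>j\<^sub>0\<close> appended. So \<open>e\<^bsub>u\<^esub>\<close> emits the first letter of \<open>\<gamma> u\<close> whichever letter it meets, and stores
  that letter at the end of the queue. After \<open>b\<close> letters the queue \<open>\<gamma> u\<close> has been emitted
  and replaced by the word met.\<close>

lemma ef_runs_imp_intertwines:
  assumes mn: "m ^ a = n ^ b" and b: "b > 0"
    and \<gamma>_in: "\<And>u. u \<in> words m a \<Longrightarrow> \<gamma> u \<in> words n b"
    and runs: "\<And>u\<^sub>0 j\<^sub>0 js us j u. u\<^sub>0 \<in> words m a \<Longrightarrow> j\<^sub>0 \<in> {1..n} \<Longrightarrow>
      ef_run m n \<theta> a b u\<^sub>0 j\<^sub>0 js us j u \<Longrightarrow> map js [1..<b + 1] = \<gamma> u\<^sub>0 \<and> j = j\<^sub>0"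
  shows "intertwines a b \<gamma>"
proof -
  have step: "\<exists>u'\<in>words m a. map E u @ [F j] \<approx> F (hd (\<gamma> u)) # map E u' \<and> \<gamma> u' = tl (\<gamma> u) @ [j]"
    if uj: "u \<in> words m a" "j \<in> {1..n}" for u j
  proof -
    obtain us js where z: "us 0 = u" "js 0 = j" and us: "\<And>k. us k \<in> words m a"
      and js: "\<And>k. js k \<in> {1..n}"
      and st: "\<And>k. map E (us k) @ map F [js k] \<approx> map F [js (Suc k)] @ map E (us (Suc k))"
      using infinite_run_exists[OF uj] by blast
    have st': "e_elt m n \<theta> (us k) \<otimes>\<^bsub>F_semigroup m n \<theta>\<^esub> f_elt m n \<theta> [js k] =
        f_elt m n \<theta> [js (Suc k)] \<otimes>\<^bsub>F_semigroup m n \<theta>\<^esub> e_elt m n \<theta> (us (Suc k))" for k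
      using commutation_iff[of "us k" "us (Suc k)" "[js k]" "[js (Suc k)]"] st[of k] us js
      by (auto simp: words_def)
    have run0: "ef_run m n \<theta> a b u j js us (js (Suc b)) (us (Suc b))"
      unfolding ef_run_def using z us js st' by simp
    have run1: "ef_run m n \<theta> a b (us 1) (js 1) (\<lambda>k. js (Suc k)) (\<lambda>k. us (Suc k))
        (js (Suc (Suc b))) (us (Suc (Suc b)))"
      unfolding ef_run_def using us js st' by simp
    have r0: "\<gamma> u = map js [1..<b + 1]" "js (Suc b) = j"
      using runs[OF uj run0] by auto
    have "\<gamma> (us 1) = map (\<lambda>k. js (Suc k)) [1..<b + 1]"
      using runs[OF us js run1] by simp
    also have "\<dots> = map js [2..<Suc (Suc b)]"
      by (simp add: numeral_2_eq_2 map_Suc_upt[symmetric] del: upt_Suc)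
    also have "\<dots> = tl (map js [1..<b + 1]) @ [js (Suc b)]"
      using b by (simp add: upt_conv_Cons numeral_2_eq_2)
    finally have "\<gamma> (us 1) = tl (\<gamma> u) @ [j]"
      using r0 by simp
    moreover have "hd (\<gamma> u) = js 1"
      using r0(1) b by (simp add: upt_conv_Cons del: upt_Suc)
    ultimately show ?thesis
      using st[of 0] us z by auto
  qed
  have queue: "\<exists>u'\<in>words m a. map E u @ map F w \<approx> map F (take (length w) (\<gamma> u)) @ map E u' \<and>
      \<gamma> u' = drop (length w) (\<gamma> u) @ w"
    if "u \<in> words m a" "set w \<subseteq> {1..n}" "length w \<le> b" for u w
    using that
  proof (induction w rule: rev_induct)
    case Nil
    then show ?case
      using F_cong.refl[of "map E u"] by (intro bexI[of _ u]) (auto simp: words_def)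
  next
    case (snoc j w)
    obtain u' where u': "u' \<in> words m a"
      "map E u @ map F w \<approx> map F (take (length w) (\<gamma> u)) @ map E u'"
      "\<gamma> u' = drop (length w) (\<gamma> u) @ w"
      using snoc by auto
    obtain u'' where u'': "u'' \<in> words m a" "map E u' @ [F j] \<approx> F (hd (\<gamma> u')) # map E u''"
      "\<gamma> u'' = tl (\<gamma> u') @ [j]"
      using step[OF u'(1), of j] snoc.prems by auto
    have len: "length w < length (\<gamma> u)"
      using snoc.prems \<gamma>_in[of u] by (simp add: words_def)
    then have hd: "hd (\<gamma> u') = \<gamma> u ! length w" and tl: "tl (\<gamma> u') = drop (Suc (length w)) (\<gamma> u) @ w"
      using u'(3) by (simp_all add: hd_append hd_drop_conv_nth drop_Suc tl_drop)
    have v: "map F (take (length w) (\<gamma> u)) \<in> letter_words" "[F j] \<in> letter_words"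
      using F_cong_lists[OF u'(2)] snoc.prems by auto
    have "map E u @ map F (w @ [j]) \<approx> map F (take (length w) (\<gamma> u)) @ map E u' @ [F j]"
      using cong_right[OF u'(2) v(2)] by simp
    also have "map F (take (length w) (\<gamma> u)) @ map E u' @ [F j] \<approx>
        map F (take (length w) (\<gamma> u)) @ F (hd (\<gamma> u')) # map E u''"
      by (rule cong_left[OF u''(2) v(1)])
    finally show ?case
      using u'' hd tl len by (intro bexI[of _ u'']) (simp_all add: take_Suc_conv_app_nth)
  qed
  have full: "\<exists>u'\<in>words m a. map E u @ map F v \<approx> map F (\<gamma> u) @ map E u' \<and> \<gamma> u' = v"
    if "u \<in> words m a" "v \<in> words n b" for u v
    using queue[of u v] that \<gamma>_in[of u] by (auto simp: words_def)
  have surj: "\<gamma> ` words m a = words n b"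
  proof
    have u1: "replicate a 1 \<in> words m a"
      using replicate_in_words m_pos by simp
    show "words n b \<subseteq> \<gamma> ` words m a"
      using full[OF u1] by blast
  qed (use \<gamma>_in in blast)
  moreover have "inj_on \<gamma> (words m a)"
    using surj mn by (intro eq_card_imp_inj_on finite_words) (simp add: card_words)
  ultimately have bij: "bij_betw \<gamma> (words m a) (words n b)"
    by (simp add: bij_betw_def)
  have "map E u @ map F v \<approx> map F (\<gamma> u) @ map E (inv_into (words m a) \<gamma> v)"
    if uv: "u \<in> words m a" "v \<in> words n b" for u v
    using full[OF uv] \<open>inj_on \<gamma> (words m a)\<close> by (auto simp: inv_into_f_f)
  then show ?thesis
    using bij by (simp add: intertwines_def)
qed

end

section \<open>The test for periodicity\<close>

theorem theorem4p7:
  fixes m n a b :: nat and \<theta> :: "nat \<times> nat \<Rightarrow> nat \<times> nat"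
  assumes "m \<ge> 2" and "n \<ge> 2"
    and "\<theta> permutes ({1..m} \<times> {1..n})"
    and "a > 0" and "b > 0"
  shows
    "(F_periodic m n \<theta> (int a) (- int b) \<longrightarrow>
       (\<forall>u\<^sub>0\<in>words m a. \<forall>j\<^sub>0\<in>{1..n}. \<forall>js us j u.
          ef_run m n \<theta> a b u\<^sub>0 j\<^sub>0 js us j u \<longrightarrow>
          (let \<gamma> = assoc_bij m n \<theta> a b; v\<^sub>0 = map js [1..<b + 1] in
             \<gamma> u\<^sub>0 = v\<^sub>0 \<and> j = j\<^sub>0 \<and> u = u\<^sub>0 \<and>
             (\<forall>i\<^sub>0\<in>{1..m}. \<forall>il vs i v.
                fe_run m n \<theta> a b v\<^sub>0 i\<^sub>0 il vs i v \<longrightarrow>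
                inv_into (words m a) \<gamma> v\<^sub>0 = rev (map il [1..<a + 1]) \<and>
                rev (map il [1..<a + 1]) = u\<^sub>0 \<and> v = v\<^sub>0 \<and> i = i\<^sub>0))))
     \<and>
     (m ^ a = n ^ b \<and>
      (\<forall>u\<^sub>0\<in>words m a. \<exists>v\<^sub>0\<in>words n b.
         (\<forall>j\<^sub>0\<in>{1..n}. \<forall>js us j u.
            ef_run m n \<theta> a b u\<^sub>0 j\<^sub>0 js us j u \<longrightarrow>
            map js [1..<b + 1] = v\<^sub>0 \<and> j = j\<^sub>0 \<and> u = u\<^sub>0) \<and>
         (\<forall>i\<^sub>0\<in>{1..m}. \<forall>il vs i v.
            fe_run m n \<theta> a b v\<^sub>0 i\<^sub>0 il vs i v \<longrightarrow>
            rev (map il [1..<a + 1]) = u\<^sub>0 \<and> v = v\<^sub>0 \<and> i = i\<^sub>0)) \<longrightarrow>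
      F_periodic m n \<theta> (int a) (- int b))"
proof (intro conjI impI)
  interpret permutation_semigroup m n \<theta>
    using assms by unfold_locales auto
  {
    assume per: "F_periodic m n \<theta> (int a) (- int b)"
    define \<gamma> where "\<gamma> = assoc_bij m n \<theta> a b"
    have int: "intertwines a b \<gamma>"
      using periodic_imp_intertwines[OF per] assoc_bij_intertwines \<gamma>_def by blast
    then have inj: "inj_on \<gamma> (words m a)"
      by (simp add: intertwines_def bij_betw_def)
    show "\<forall>u\<^sub>0\<in>words m a. \<forall>j\<^sub>0\<in>{1..n}. \<forall>js us j u.
          ef_run m n \<theta> a b u\<^sub>0 j\<^sub>0 js us j u \<longrightarrow>
          (let \<gamma> = assoc_bij m n \<theta> a b; v\<^sub>0 = map js [1..<b + 1] in
             \<gamma> u\<^sub>0 = v\<^sub>0 \<and> j = j\<^sub>0 \<and> u = u\<^sub>0 \<and>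
             (\<forall>i\<^sub>0\<in>{1..m}. \<forall>il vs i v.
                fe_run m n \<theta> a b v\<^sub>0 i\<^sub>0 il vs i v \<longrightarrow>
                inv_into (words m a) \<gamma> v\<^sub>0 = rev (map il [1..<a + 1]) \<and>
                rev (map il [1..<a + 1]) = u\<^sub>0 \<and> v = v\<^sub>0 \<and> i = i\<^sub>0))"
      unfolding Let_def \<gamma>_def[symmetric]
    proof (intro ballI allI impI)
      fix u\<^sub>0 j\<^sub>0 js us j u
      assume u\<^sub>0: "u\<^sub>0 \<in> words m a" and run: "ef_run m n \<theta> a b u\<^sub>0 j\<^sub>0 js us j u"
      note ef = ef_run_intertwines[OF int \<open>b > 0\<close> run]
      show "\<gamma> u\<^sub>0 = map js [1..<b + 1] \<and> j = j\<^sub>0 \<and> u = u\<^sub>0 \<and>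
             (\<forall>i\<^sub>0\<in>{1..m}. \<forall>il vs i v.
                fe_run m n \<theta> a b (map js [1..<b + 1]) i\<^sub>0 il vs i v \<longrightarrow>
                inv_into (words m a) \<gamma> (map js [1..<b + 1]) = rev (map il [1..<a + 1]) \<and>
                rev (map il [1..<a + 1]) = u\<^sub>0 \<and> v = map js [1..<b + 1] \<and> i = i\<^sub>0)"
        unfolding ef(1)[symmetric]
        using ef(2,3) fe_run_intertwines[OF int \<open>a > 0\<close> u\<^sub>0] inv_into_f_f[OF inj u\<^sub>0] by metis
    qed
  next
    assume *: "m ^ a = n ^ b \<and>
      (\<forall>u\<^sub>0\<in>words m a. \<exists>v\<^sub>0\<in>words n b.
         (\<forall>j\<^sub>0\<in>{1..n}. \<forall>js us j u.
            ef_run m n \<theta> a b u\<^sub>0 j\<^sub>0 js us j u \<longrightarrow>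
            map js [1..<b + 1] = v\<^sub>0 \<and> j = j\<^sub>0 \<and> u = u\<^sub>0) \<and>
         (\<forall>i\<^sub>0\<in>{1..m}. \<forall>il vs i v.
            fe_run m n \<theta> a b v\<^sub>0 i\<^sub>0 il vs i v \<longrightarrow>
            rev (map il [1..<a + 1]) = u\<^sub>0 \<and> v = v\<^sub>0 \<and> i = i\<^sub>0))"
    then have "\<forall>u\<^sub>0\<in>words m a. \<exists>v\<^sub>0. v\<^sub>0 \<in> words n b \<and>
         (\<forall>j\<^sub>0\<in>{1..n}. \<forall>js us j u.
            ef_run m n \<theta> a b u\<^sub>0 j\<^sub>0 js us j u \<longrightarrow> map js [1..<b + 1] = v\<^sub>0 \<and> j = j\<^sub>0)"
      by meson
    from bchoice[OF this] obtain \<gamma> where \<gamma>: "\<forall>u\<^sub>0\<in>words m a. \<gamma> u\<^sub>0 \<in> words n b \<and>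
         (\<forall>j\<^sub>0\<in>{1..n}. \<forall>js us j u.
            ef_run m n \<theta> a b u\<^sub>0 j\<^sub>0 js us j u \<longrightarrow> map js [1..<b + 1] = \<gamma> u\<^sub>0 \<and> j = j\<^sub>0)"
      by blast
    have "intertwines a b \<gamma>"
    proof (rule ef_runs_imp_intertwines)
      show "m ^ a = n ^ b"
        using * by blast
      fix u\<^sub>0 j\<^sub>0 js us j u
      assume "u\<^sub>0 \<in> words m a" "j\<^sub>0 \<in> {1..n}" "ef_run m n \<theta> a b u\<^sub>0 j\<^sub>0 js us j u"
      then show "map js [1..<b + 1] = \<gamma> u\<^sub>0 \<and> j = j\<^sub>0"
        using \<gamma> by blast
    qed (use \<gamma> \<open>b > 0\<close> in auto)
    then show "F_periodic m n \<theta> (int a) (- int b)"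
      using intertwines_imp_periodic \<open>a > 0\<close> \<open>b > 0\<close> by blast
  }
qed

end
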